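(* Let $\lambda_i,\mu_i\in\mathbb{C}$ ($i=1,2,3$) satisfy $\sum\lambda_i=\sum\mu_i$, and set $$\theta_1=\lambda_1-\mu_1,\quad\theta_2=\lambda_2-\mu_1,\quad\theta_3=\lambda_3-\mu_1,\quad\theta_4=\mu_3-\mu_2.$$ Let $y(t)$ be a solution of $\mathrm{P}_{\mathrm{VI}}$ with parameters $\theta=(\theta_1,\theta_2,\theta_3,\theta_4)$, considered where it is holomorphic with $y\neq 0,1,t$, and define $x(t)$ by $$2x=\frac{(t-1)y'-\theta_1}{y}+\frac{y'-1-\theta_2}{y-t}-\frac{t\,y'+\theta_3}{y-1},\qquad y'=\frac{dy}{dt}.$$ Define $$B_1=\begin{pmatrix}\lambda_1 & b_{12} & b_{13} \\ 0 & 0 & 0 \\ 0 & 0 & 0\end{pmatrix},\qquad B_2=\begin{pmatrix}0 & 0 & 0 \\ b_{21} & \lambda_2 & b_{23} \\ 0 & 0 & 0\end{pmatrix},\qquad B_3=\begin{pmatrix}0 & 0 & 0 \\ 0 & 0 & 0 \\ b_{31} & b_{32} & \lambda_3\end{pmatrix},$$ where $$\begin{aligned} b_{12}&=\lambda_1-\mu_3y+(\mu_1-xy)(y-1), & b_{32}&=(\mu_2-\lambda_2-b_{12})/t, \\ b_{13}&=\lambda_1t-\mu_3y+(\mu_1-xy)(y-t), & b_{23}&=(\mu_2-\lambda_3)t-b_{13}, \\ b_{21}&=\lambda_2+\frac{\mu_3(y-t)-\mu_1(y-1)+x(y-t)(y-1)}{t-1}, & b_{31}&=(\mu_2-\lambda_1-b_{21})/t.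 \end{aligned}$$ Then the family of Fuchsian systems $$\frac{d}{dz}-\left(\frac{B_1}{z}+\frac{B_2}{z-t}+\frac{B_3}{z-1}\right)$$ is isomonodromic as $t$ varies.
   Context: The sixth Painlevé equation $\mathrm{P}_{\mathrm{VI}}$ with parameters $\theta=(\theta_1,\theta_2,\theta_3,\theta_4)$ is $$\begin{aligned}\frac{d^2y}{dt^2}=&\frac12\left(\frac1y+\frac1{y-1}+\frac1{y-t}\right)\left(\frac{dy}{dt}\right)^2-\left(\frac1t+\frac1{t-1}+\frac1{y-t}\right)\frac{dy}{dt}\\&+\frac{y(y-1)(y-t)}{2t^2(t-1)^2}\left((\theta_4-1)^2-\frac{\theta_1^2\,t}{y^2}+\frac{\theta_3^2(t-1)}{(y-1)^2}+\frac{(1-\theta_2^2)t(t-1)}{(y-t)^2}\right),\end{aligned}$$ with $t\in\mathbb{P}^1\setminus\{0,1,\infty\}$. A family of Fuchsian systems with poles at $z=0,t,1,\infty$ is isomonodromic if, as $t$ varies locally in $\mathbb{P}^1\setminus\{0,1,\infty\}$, the conjugacy class of its monodromy representation $\pi_1(\mathbb{P}^1\setminus\{0,t,1,\infty\})\to\mathrm{GL}_3(\mathbb{C})$ is constant, where the fundamental groups for nearby values of $t$ are canonically identified via the family of four-punctured spheres over a disk in the $t$-plane. *)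

theory Defs
  imports "HOL-Analysis.Analysis"
begin

definition solves_PVI_on ::
  "complex set \<Rightarrow> complex \<Rightarrow> complex \<Rightarrow> complex \<Rightarrow> complex \<Rightarrow> (complex \<Rightarrow> complex) \<Rightarrow> bool"
where
  "solves_PVI_on U \<theta>1 \<theta>2 \<theta>3 \<theta>4 y \<longleftrightarrow>
     y holomorphic_on U \<and>
     (\<forall>t\<in>U. deriv (deriv y) t =
        1 / 2 * (1 / y t + 1 / (y t - 1) + 1 / (y t - t)) * (deriv y t)\<^sup>2
        - (1 / t + 1 / (t - 1) + 1 / (y t - t)) * deriv y t
        + y t * (y t - 1) * (y t - t) / (2 * t\<^sup>2 * (t - 1)\<^sup>2)
          * ((\<theta>4 - 1)\<^sup>2 - \<theta>1\<^sup>2 * t / (y t)\<^sup>2 + \<theta>3\<^sup>2 * (t - 1) / (y t - 1)\<^sup>2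
             + (1 - \<theta>2\<^sup>2) * t * (t - 1) / (y t - t)\<^sup>2))"

definition fuchsian_matrix ::
  "complex^'n^'n \<Rightarrow> complex^'n^'n \<Rightarrow> complex^'n^'n \<Rightarrow> complex \<Rightarrow> complex \<Rightarrow> complex^'n^'n"
where
  "fuchsian_matrix B1 B2 B3 t z =
     (\<chi> i j. B1 $ i $ j / z + B2 $ i $ j / (z - t) + B3 $ i $ j / (z - 1))"

definition matrix_solution_on ::
  "(complex \<Rightarrow> complex^'n^'n) \<Rightarrow> complex set \<Rightarrow> (complex \<Rightarrow> complex^'n^'n) \<Rightarrow> bool"
where
  "matrix_solution_on A S \<Phi> \<longleftrightarrow>
     (\<forall>z\<in>S. \<forall>i j. ((\<lambda>w. \<Phi> w $ i $ j) has_field_derivative (A z ** \<Phi> z) $ i $ j) (at z))"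

text \<open>Analytic continuation along \<open>\<gamma>\<close>: \<open>Y s\<close> is the value at \<open>\<gamma> s\<close> of the germ obtained by
  continuing the solution germ at \<open>\<gamma> 0\<close> along the restriction of \<open>\<gamma>\<close> to \<open>[0,s]\<close>.\<close>

definition continued_along ::
  "(complex \<Rightarrow> complex^'n^'n) \<Rightarrow> (real \<Rightarrow> complex) \<Rightarrow> (real \<Rightarrow> complex^'n^'n) \<Rightarrow> bool"
where
  "continued_along A \<gamma> Y \<longleftrightarrow>
     (\<forall>s\<in>{0..1}. \<exists>\<Phi> e d. 0 < e \<and> 0 < d \<and> matrix_solution_on A (ball (\<gamma> s) e) \<Phi> \<and>
        (\<forall>r\<in>{0..1}. dist r s < d \<longrightarrow> \<gamma> r \<in> ball (\<gamma> s) e \<and> Y r = \<Phi> (\<gamma> r)))"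

text \<open>For a loop \<open>\<gamma>\<close>, the matrix \<open>M\<close> such that the fundamental solution with value \<open>1\<close> at the
  base point is continued along \<open>\<gamma>\<close> to that solution times \<open>M\<close>.\<close>

definition monodromy :: "(complex \<Rightarrow> complex^'n^'n) \<Rightarrow> (real \<Rightarrow> complex) \<Rightarrow> complex^'n^'n"
where
  "monodromy A \<gamma> = (THE M. \<exists>Y. continued_along A \<gamma> Y \<and> Y 0 = mat 1 \<and> Y 1 = M)"

definition punctured_spheres :: "complex set \<Rightarrow> (complex \<times> complex) set"
where
  "punctured_spheres D = {(t, z). t \<in> D \<and> z \<notin> {0, t, 1}}"

text \<open>The canonical identification of \<open>\<pi>\<^sub>1\<close> of the fibres over \<open>t1\<close> and \<open>t2\<close>, with base points
  given by a section \<open>b\<close> over the disk \<open>D\<close>: loops in two fibres correspond if they are homotopic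
  in the total space through loops based at points of the section.  As \<open>D\<close> is simply connected,
  the path followed by the base point is immaterial.\<close>

definition corresponding_loops ::
  "complex set \<Rightarrow> (complex \<Rightarrow> complex) \<Rightarrow> complex \<Rightarrow> (real \<Rightarrow> complex) \<Rightarrow> complex \<Rightarrow> (real \<Rightarrow> complex) \<Rightarrow> bool"
where
  "corresponding_loops D b t1 \<gamma>1 t2 \<gamma>2 \<longleftrightarrow>
     homotopic_with_canon
       (\<lambda>g. pathfinish g = pathstart g \<and> pathstart g \<in> (\<lambda>t. (t, b t)) ` D)
       {0..1} (punctured_spheres D) (\<lambda>s. (t1, \<gamma>1 s)) (\<lambda>s. (t2, \<gamma>2 s))"

text \<open>\<open>A t\<close> is the coefficient matrix, on the sphere minus \<open>0, t, 1, \<infinity>\<close>, of the member of the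
  family with parameter \<open>t\<close>.\<close>

definition isomonodromic_on ::
  "complex set \<Rightarrow> (complex \<Rightarrow> complex \<Rightarrow> complex^'n^'n) \<Rightarrow> bool"
where
  "isomonodromic_on U A \<longleftrightarrow>
     (\<forall>t0 r b. let D = ball t0 r in
        D \<subseteq> U - {0, 1} \<and> continuous_on D b \<and> (\<forall>t\<in>D. b t \<notin> {0, t, 1}) \<longrightarrow>
        (\<forall>t1\<in>D. \<forall>t2\<in>D. \<exists>C. invertible C \<and>
           (\<forall>\<gamma>1 \<gamma>2. corresponding_loops D b t1 \<gamma>1 t2 \<gamma>2 \<longrightarrow>
              monodromy (A t2) \<gamma>2 = C ** monodromy (A t1) \<gamma>1 ** matrix_inv C)))"

end

theory Submission
  imports Defs "HOL-Complex_Analysis.Cauchy_Integral_Formula"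
begin

text \<open>
  The Fuchsian systems of the family are the restrictions to the fibres \<open>t = const\<close> of a connection on the
  space of pairs \<open>(t, z)\<close> with \<open>z\<close> distinct from \<open>0\<close>, \<open>t\<close> and \<open>1\<close>: with
  \<open>A = B1 / z + B2 / (z - t) + B3 / (z - 1)\<close> and \<open>\<Omega> = P - B2 / (z - t)\<close>, for a suitable matrix \<open>P\<close> depending on
  \<open>t\<close> only, consider \<open>d\<Phi> = (A dz + \<Omega> dt) \<Phi>\<close>.  The theorem holds because this connection is flat.

  Flatness is the equation \<open>\<partial>A/\<partial>t + A \<Omega> = \<partial>\<Omega>/\<partial>z + \<Omega> A\<close>.  Comparing poles in \<open>z\<close> turns it into the Schlesinger
  equations for \<open>B1\<close>, \<open>B2\<close>, \<open>B3\<close>, corrected by commutators with \<open>P\<close> (\<open>schlesinger_zero_curvature\<close>).  The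
  correction is needed because the matrices of the family are normalised: \<open>Bi\<close> has a nonzero \<open>i\<close>-th row only,
  and \<open>(1, 1, t)\<close> is a left eigenvector of their sum.  These normalisations determine \<open>P\<close> (\<open>gauge3\<close>).
  On the other side, \<open>x\<close> is the momentum conjugate to \<open>y\<close>, and the Painleve equation is equivalent to a
  Hamiltonian system for \<open>(x, y)\<close> with right-hand sides polynomial in \<open>x\<close> and \<open>y\<close>
  (\<open>PVI_slope\<close>, \<open>PVI_hamilton\<close>).  As the entries of the matrices are polynomial in \<open>x\<close> and \<open>y\<close> too, the
  Schlesinger equations reduce to polynomial identities (\<open>schlesinger_scalar_equations\<close>).

  A flat connection has local frames (\<open>flat_frame_exists\<close>), which are constructed here by power series in \<open>z\<close>
  with coefficients holomorphic in \<open>t\<close>.  Any two of them differ by a constant matrix, so they define a local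
  system on the total space.  Its parallel transport along a path in a fibre is the analytic continuation of
  solutions (\<open>continued_along_iff_parallel\<close>), and it is invariant under homotopies because a local system on a
  square is trivial (\<open>liftable_square\<close>).  Loops in two fibres that correspond to each other are homotopic in
  the total space, with a base point that moves along the given section.  Hence their monodromies are conjugate
  by the transport along the path of the base point, and since the section lies over a disk this transport depends
  only on the ends of the path (\<open>isomonodromic\<close>).
\<close>

section \<open>Derivatives of matrix-valued functions\<close>

definition has_matrix_derivative ::
  "(complex \<Rightarrow> complex^'n^'m) \<Rightarrow> complex^'n^'m \<Rightarrow> complex \<Rightarrow> bool"
where
  "has_matrix_derivative F F' x \<longleftrightarrow>
     (\<forall>i j. ((\<lambda>w. F w $ i $ j) has_field_derivative F' $ i $ j) (at x))"

lemma has_matrix_derivativeD: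
  "has_matrix_derivative F F' x \<Longrightarrow> ((\<lambda>w. F w $ i $ j) has_field_derivative F' $ i $ j) (at x)"
  by (simp add: has_matrix_derivative_def)

lemma has_matrix_derivative_mult:
  fixes F :: "complex \<Rightarrow> complex^'n^'m" and G :: "complex \<Rightarrow> complex^'k^'n"
  assumes "has_matrix_derivative F F' x" "has_matrix_derivative G G' x"
  shows "has_matrix_derivative (\<lambda>w. F w ** G w) (F' ** G x + F x ** G') x"
  using assms unfolding has_matrix_derivative_def matrix_matrix_mult_def
  by (auto intro!: derivative_eq_intros simp: sum.distrib add.commute mult.commute)

lemma has_matrix_derivative_const: "has_matrix_derivative (\<lambda>w. K) 0 x"
  by (simp add: has_matrix_derivative_def)

lemma has_matrix_derivative_add:
  assumes "has_matrix_derivative F F' x" "has_matrix_derivative G G' x"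
  shows "has_matrix_derivative (\<lambda>w. F w + G w) (F' + G') x"
  using assms by (auto simp: has_matrix_derivative_def intro!: derivative_eq_intros)

lemma has_matrix_derivative_diff:
  assumes "has_matrix_derivative F F' x" "has_matrix_derivative G G' x"
  shows "has_matrix_derivative (\<lambda>w. F w - G w) (F' - G') x"
  using assms by (auto simp: has_matrix_derivative_def intro!: derivative_eq_intros)

lemma has_matrix_derivative_transpose:
  "has_matrix_derivative F F' x \<Longrightarrow> has_matrix_derivative (\<lambda>w. transpose (F w)) (transpose F') x"
  by (simp add: has_matrix_derivative_def transpose_def)

lemma has_matrix_derivative_unique:
  assumes "has_matrix_derivative F F' x" "has_matrix_derivative F F'' x"
  shows "F' = F''"
  unfolding vec_eq_iff using has_matrix_derivativeD[OF assms(1)] has_matrix_derivativeD[OF assms(2)] DERIV_unique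
  by blast

lemma has_matrix_derivative_shift:
  "has_matrix_derivative F F' (x - a) \<Longrightarrow> has_matrix_derivative (\<lambda>w. F (w - a)) F' x"
  unfolding has_matrix_derivative_def
  using DERIV_shift[of _ _ x "- a"] by simp

lemma has_matrix_derivative_cong:
  assumes "has_matrix_derivative F F' x" "open S" "x \<in> S" "\<And>w. w \<in> S \<Longrightarrow> F w = G w"
  shows "has_matrix_derivative G F' x"
  unfolding has_matrix_derivative_def
proof (intro allI)
  fix i j
  show "((\<lambda>w. G w $ i $ j) has_field_derivative F' $ i $ j) (at x)"
    using has_field_derivative_transform_within_open[OF has_matrix_derivativeD[OF assms(1), of i j] assms(2,3)]
      assms(4) by simp
qed

lemma has_matrix_derivative_zero_constant:
  assumes "convex S" "open S" "\<And>x. x \<in> S \<Longrightarrow> has_matrix_derivative F 0 x" "x \<in> S" "y \<in> S"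
  shows "F x = F y"
proof -
  have "F x $ i $ j = F y $ i $ j" for i j
  proof -
    have "\<exists>c. \<forall>x\<in>S. F x $ i $ j = c"
      by (rule has_field_derivative_zero_constant[OF assms(1)])
        (use assms(3) in \<open>auto simp: has_matrix_derivative_def intro: has_field_derivative_at_within\<close>)
    with assms show ?thesis by auto
  qed
  then show ?thesis by (simp add: vec_eq_iff)
qed

lemma matrix_solution_on_iff:
  "matrix_solution_on A S \<Phi> \<longleftrightarrow> (\<forall>z\<in>S. has_matrix_derivative \<Phi> (A z ** \<Phi> z) z)"
  by (simp add: matrix_solution_on_def has_matrix_derivative_def)

section \<open>Power series depending on a parameter\<close>

lemma summable_power_bound:
  fixes c :: "nat \<Rightarrow> complex"
  assumes "\<And>k. norm (c k) \<le> C * L ^ k" "0 < L" "norm w < 1 / L"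
  shows "summable (\<lambda>k. norm (c k * w ^ k))"
proof (rule summable_comparison_test'[where N = 0])
  have "norm (L * norm w) < 1"
    using assms by (simp add: field_simps)
  then show "summable (\<lambda>k. C * (L * norm w) ^ k)"
    by (intro summable_mult summable_geometric) auto
  show "norm (norm (c k * w ^ k)) \<le> C * (L * norm w) ^ k" for k
    using mult_right_mono[OF assms(1)[of k], of "norm w ^ k"]
    by (simp add: norm_mult norm_power power_mult_distrib mult.assoc)
qed

text \<open>By the bound the partial sums converge uniformly in \<open>t\<close>, and a uniform limit of holomorphic
  functions may be differentiated termwise.\<close>

lemma power_series_deriv_param:
  fixes c :: "nat \<Rightarrow> complex \<Rightarrow> complex"
  assumes T: "open T" and hol: "\<And>k. c k holomorphic_on T"
    and bound: "\<And>k t. t \<in> T \<Longrightarrow> norm (c k t) \<le> C * L ^ k"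
    and L: "0 < L" and w: "norm w < 1 / L" and t: "t \<in> T"
  shows "summable (\<lambda>k. deriv (c k) t * w ^ k)"
    and "((\<lambda>t. \<Sum>k. c k t * w ^ k) has_field_derivative (\<Sum>k. deriv (c k) t * w ^ k)) (at t)"
proof -
  have "norm (L * norm w) < 1"
    using L w by (simp add: field_simps)
  then have sm: "summable (\<lambda>k. C * (L * norm w) ^ k)"
    by (intro summable_mult summable_geometric) auto
  have ul: "uniform_limit T (\<lambda>n t. \<Sum>k<n. c k t * w ^ k) (\<lambda>t. \<Sum>k. c k t * w ^ k) sequentially"
  proof (rule Weierstrass_m_test[OF _ sm])
    show "norm (c k t * w ^ k) \<le> C * (L * norm w) ^ k" if "t \<in> T" for k t
      using mult_right_mono[OF bound[OF that, of k], of "norm w ^ k"]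
      by (simp add: norm_mult norm_power power_mult_distrib mult.assoc)
  qed
  have "\<exists>g'. \<forall>x\<in>T. ((\<lambda>t. \<Sum>k. c k t * w ^ k) has_field_derivative g' x) (at x) \<and>
      (\<lambda>n. \<Sum>k<n. deriv (c k) x * w ^ k) \<longlonglongrightarrow> g' x"
  proof (rule has_complex_derivative_uniform_sequence[OF T])
    show "((\<lambda>t. \<Sum>k<n. c k t * w ^ k) has_field_derivative (\<Sum>k<n. deriv (c k) x * w ^ k)) (at x)"
      if "x \<in> T" for n x
      using holomorphic_derivI[OF hol T that] by (auto intro!: derivative_eq_intros)
    show "\<exists>d>0. cball x d \<subseteq> T \<and>
        uniform_limit (cball x d) (\<lambda>n t. \<Sum>k<n. c k t * w ^ k) (\<lambda>t. \<Sum>k. c k t * w ^ k) sequentially"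
      if "x \<in> T" for x
      using T that uniform_limit_on_subset[OF ul] by (meson open_contains_cball)
  qed
  then obtain g' where g': "((\<lambda>t. \<Sum>k. c k t * w ^ k) has_field_derivative g') (at t)"
    and lim: "(\<lambda>n. \<Sum>k<n. deriv (c k) t * w ^ k) \<longlonglongrightarrow> g'"
    using t by blast
  from lim have "(\<lambda>k. deriv (c k) t * w ^ k) sums g'"
    by (simp add: sums_def)
  then show "summable (\<lambda>k. deriv (c k) t * w ^ k)"
    and "((\<lambda>t. \<Sum>k. c k t * w ^ k) has_field_derivative (\<Sum>k. deriv (c k) t * w ^ k)) (at t)"
    using g' by (auto simp: sums_iff)
qed

text \<open>The expansion is in \<open>w\<close> only, and its coefficients are holomorphic in \<open>t\<close>.  Termwise differentiation
  then turns both orders of the mixed derivative into one and the same series \<open>f12\<close>; this is how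
  second derivatives are interchanged below.  The radius is halved because the factor \<open>k + 1\<close> that
  \<open>diffs\<close> introduces is absorbed into \<open>2 ^ k\<close>.\<close>

lemma power_series_mixed_derivs:
  fixes c :: "nat \<Rightarrow> complex \<Rightarrow> complex"
  assumes T: "open T" and hol: "\<And>k. c k holomorphic_on T"
    and bound: "\<And>k t. t \<in> T \<Longrightarrow> norm (c k t) \<le> C * L ^ k"
    and L: "0 < L" and w: "norm w < 1 / (2 * L)" and t: "t \<in> T"
  defines "f \<equiv> \<lambda>t w. \<Sum>k. c k t * w ^ k"
    and "f1 \<equiv> \<lambda>t w. \<Sum>k. deriv (c k) t * w ^ k"
    and "f2 \<equiv> \<lambda>t w. \<Sum>k. diffs (\<lambda>k. c k t) k * w ^ k"
    and "f12 \<equiv> \<lambda>t w. \<Sum>k. diffs (\<lambda>k. deriv (c k) t) k * w ^ k"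
  shows "((\<lambda>t. f t w) has_field_derivative f1 t w) (at t)"
    and "(f t has_field_derivative f2 t w) (at w)"
    and "(f1 t has_field_derivative f12 t w) (at w)"
    and "((\<lambda>t. f2 t w) has_field_derivative f12 t w) (at t)"
proof -
  have w1: "norm w < 1 / L"
    by (rule less_le_trans[OF w]) (use L in \<open>simp add: field_simps\<close>)
  have C: "0 \<le> C"
    using order_trans[OF norm_ge_zero bound[OF t, of 0]] by simp
  show "((\<lambda>t. f t w) has_field_derivative f1 t w) (at t)"
    unfolding f_def f1_def by (rule power_series_deriv_param[OF T hol bound L w1 t])
  show "(f t has_field_derivative f2 t w) (at w)"
    unfolding f_def f2_def
    by (rule termdiffs_strong'[OF _ w1], rule summable_norm_cancel)
      (rule summable_power_bound[OF bound[OF t] L])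
  show "(f1 t has_field_derivative f12 t w) (at w)"
    unfolding f1_def f12_def
    by (rule termdiffs_strong'[OF _ w1]) (rule power_series_deriv_param(1)[OF T hol bound L _ t])
  have "norm (of_nat (Suc k) * c (Suc k) t) \<le> (C * L) * (2 * L) ^ k" if "t \<in> T" for k t
  proof -
    have "Suc k \<le> 2 ^ k"
      by (simp add: Suc_leI)
    then have "real (Suc k) \<le> real (2 ^ k)"
      by (rule of_nat_mono)
    then have "real (Suc k) * norm (c (Suc k) t) \<le> 2 ^ k * (C * L ^ Suc k)"
      by (intro mult_mono bound that) auto
    also have "\<dots> = (C * L) * (2 * L) ^ k"
      by (simp add: power_mult_distrib)
    finally show ?thesis
      by (simp add: norm_mult del: of_nat_Suc)
  qed
  note * = power_series_deriv_param(2)[OF T _ this _ w t]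
  have "((\<lambda>t. \<Sum>k. (of_nat (Suc k) * c (Suc k) t) * w ^ k) has_field_derivative
     (\<Sum>k. deriv (\<lambda>t. of_nat (Suc k) * c (Suc k) t) t * w ^ k)) (at t)"
    by (rule *) (use L hol in \<open>auto intro!: holomorphic_intros simp del: of_nat_Suc\<close>)
  moreover have "deriv (\<lambda>t. of_nat (Suc k) * c (Suc k) t) t = of_nat (Suc k) * deriv (c (Suc k)) t" for k
    using holomorphic_on_imp_differentiable_at[OF hol T t] by (intro deriv_cmult)
  ultimately show "((\<lambda>t. f2 t w) has_field_derivative f12 t w) (at t)"
    unfolding f2_def f12_def diffs_def by simp
qed

section \<open>Linear differential equations with a parameter\<close>

text \<open>The recursion obtained by comparing coefficients in \<open>W' = A W\<close>, \<open>W 0 = mat 1\<close>, where \<open>A\<close> has the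
  coefficients \<open>a\<close>.\<close>

fun ode_coeff :: "(nat \<Rightarrow> complex^'n^'n) \<Rightarrow> nat \<Rightarrow> complex^'n^'n" where
  "ode_coeff a 0 = mat 1"
| "ode_coeff a (Suc k) = (\<chi> i l. (\<Sum>j\<le>k. (a j ** ode_coeff a (k - j)) $ i $ l) / of_nat (Suc k))"

text \<open>Each of the \<open>k\<close> products in the recursion for the \<open>k\<close>-th coefficient is bounded by \<open>L ^ k\<close>, and the
  division by \<open>k\<close> compensates for their number.  Hence a geometric bound, uniform in any parameter, passes
  from the equation to its solution.\<close>

lemma ode_coeff_bound:
  fixes a :: "nat \<Rightarrow> complex^'n^'n"
  assumes bound: "\<And>j i l. norm (a j $ i $ l) \<le> M * \<rho> ^ j" and M: "0 \<le> M" and \<rho>: "0 < \<rho>"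
    and L: "\<rho> \<le> L" "M * CARD('n) \<le> L"
  shows "norm (ode_coeff a k $ i $ l) \<le> L ^ k"
proof (induction k arbitrary: i l rule: less_induct)
  case (less k)
  show ?case
  proof (cases k)
    case 0
    then show ?thesis by (simp add: mat_def)
  next
    case (Suc m)
    have "norm ((a j ** ode_coeff a (m - j)) $ i $ l) \<le> L ^ Suc m" if "j \<le> m" for j
    proof -
      have "norm ((a j ** ode_coeff a (m - j)) $ i $ l)
          \<le> (\<Sum>q\<in>UNIV. norm (a j $ i $ q * ode_coeff a (m - j) $ q $ l))"
        unfolding matrix_matrix_mult_def by (simp add: norm_sum)
      also have "\<dots> \<le> (\<Sum>q\<in>(UNIV::'n set). (M * L ^ j) * L ^ (m - j))"
      proof (rule sum_mono)
        fix q
        have "M * \<rho> ^ j \<le> M * L ^ j"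
          using M \<rho> L(1) by (intro mult_left_mono power_mono) auto
        then show "norm (a j $ i $ q * ode_coeff a (m - j) $ q $ l) \<le> (M * L ^ j) * L ^ (m - j)"
          unfolding norm_mult using bound[of j i q] less[of "m - j" q l] Suc M \<rho> L(1)
          by (intro mult_mono) auto
      qed
      also have "\<dots> = (M * CARD('n)) * L ^ m"
        using that by (simp add: power_add[symmetric] mult.assoc)
      also have "\<dots> \<le> L * L ^ m"
        using L \<rho> by (intro mult_right_mono) auto
      finally show ?thesis by simp
    qed
    then have "norm (\<Sum>j\<le>m. (a j ** ode_coeff a (m - j)) $ i $ l) \<le> (\<Sum>j\<le>m. L ^ Suc m)"
      by (intro sum_norm_le) auto
    then show ?thesis
      using Suc by (simp add: norm_divide field_simps del: of_nat_Suc)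
  qed
qed

lemma ode_coeff_holomorphic:
  fixes a :: "nat \<Rightarrow> complex \<Rightarrow> complex^'n^'n"
  assumes "\<And>j i l. (\<lambda>t. a j t $ i $ l) holomorphic_on T"
  shows "(\<lambda>t. ode_coeff (\<lambda>j. a j t) k $ i $ l) holomorphic_on T"
proof (induction k arbitrary: i l rule: less_induct)
  case (less k)
  then show ?case
    using assms
    by (cases k) (auto simp: matrix_matrix_mult_def simp del: of_nat_Suc intro!: holomorphic_intros)
qed

definition power_series_matrix :: "(nat \<Rightarrow> complex^'n^'m) \<Rightarrow> complex \<Rightarrow> complex^'n^'m" where
  "power_series_matrix a w = (\<chi> i l. \<Sum>k. a k $ i $ l * w ^ k)"

lemma ode_series_identity:
  fixes a :: "nat \<Rightarrow> complex^'n^'n"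
  assumes bound: "\<And>j i l. norm (a j $ i $ l) \<le> M * \<rho> ^ j" and M: "0 \<le> M" and \<rho>: "0 < \<rho>"
    and L: "\<rho> \<le> L" "M * CARD('n) \<le> L" and w: "norm w < 1 / L"
  shows "(power_series_matrix a w ** power_series_matrix (ode_coeff a) w) $ i $ l =
    (\<Sum>k. diffs (\<lambda>k. ode_coeff a k $ i $ l) k * w ^ k)"
proof -
  have L0: "0 < L" using \<rho> L by simp
  have w\<rho>: "norm w < 1 / \<rho>"
    by (rule less_le_trans[OF w]) (use L \<rho> in \<open>simp add: frac_le\<close>)
  have "(\<lambda>k. \<Sum>j\<le>k. (a j $ i $ q * w ^ j) * (ode_coeff a (k - j) $ q $ l * w ^ (k - j))) sums
      ((\<Sum>k. a k $ i $ q * w ^ k) * (\<Sum>k. ode_coeff a k $ q $ l * w ^ k))" for q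
    by (intro Cauchy_product_sums summable_power_bound[OF bound \<rho> w\<rho>]
        summable_power_bound[where C = 1, OF _ L0 w])
      (use ode_coeff_bound[OF bound M \<rho> L] in simp)
  then have "(\<lambda>k. \<Sum>q\<in>UNIV. \<Sum>j\<le>k. (a j $ i $ q * w ^ j) * (ode_coeff a (k - j) $ q $ l * w ^ (k - j)))
      sums (\<Sum>q\<in>UNIV. (\<Sum>k. a k $ i $ q * w ^ k) * (\<Sum>k. ode_coeff a k $ q $ l * w ^ k))"
    by (rule sums_sum)
  also have "(\<Sum>q\<in>UNIV. (\<Sum>k. a k $ i $ q * w ^ k) * (\<Sum>k. ode_coeff a k $ q $ l * w ^ k)) =
      (power_series_matrix a w ** power_series_matrix (ode_coeff a) w) $ i $ l"
    by (simp add: matrix_matrix_mult_def power_series_matrix_def)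
  also have "(\<lambda>k. \<Sum>q\<in>UNIV. \<Sum>j\<le>k. (a j $ i $ q * w ^ j) * (ode_coeff a (k - j) $ q $ l * w ^ (k - j))) =
      (\<lambda>k. diffs (\<lambda>k. ode_coeff a k $ i $ l) k * w ^ k)"
  proof
    fix k
    have "(\<Sum>q\<in>UNIV. \<Sum>j\<le>k. (a j $ i $ q * w ^ j) * (ode_coeff a (k - j) $ q $ l * w ^ (k - j))) =
      (\<Sum>q\<in>UNIV. \<Sum>j\<le>k. (a j $ i $ q * ode_coeff a (k - j) $ q $ l) * w ^ k)"
    proof (intro sum.cong refl)
      fix q j assume "j \<in> {..k}"
      then have "w ^ k = w ^ j * w ^ (k - j)"
        by (simp add: power_add[symmetric])
      then show "(a j $ i $ q * w ^ j) * (ode_coeff a (k - j) $ q $ l * w ^ (k - j)) =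
          (a j $ i $ q * ode_coeff a (k - j) $ q $ l) * w ^ k"
        by simp
    qed
    also have "\<dots> = (\<Sum>j\<le>k. (a j ** ode_coeff a (k - j)) $ i $ l) * w ^ k"
      by (subst sum.swap) (simp add: matrix_matrix_mult_def sum_distrib_right)
    finally show "(\<Sum>q\<in>UNIV. \<Sum>j\<le>k. (a j $ i $ q * w ^ j) * (ode_coeff a (k - j) $ q $ l * w ^ (k - j))) =
        diffs (\<lambda>k. ode_coeff a k $ i $ l) k * w ^ k"
      by (simp add: diffs_def del: of_nat_Suc)
  qed
  finally show ?thesis
    by (simp add: sums_iff)
qed

lemma power_series_matrix_0 [simp]: "power_series_matrix a 0 = a 0"
  unfolding power_series_matrix_def vec_eq_iff
  by (simp add: powser_zero)

text \<open>In the last conclusion \<open>D\<close> is the mixed derivative of \<open>W\<close>: the \<open>w\<close> derivative of \<open>W1\<close>, and the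
  \<open>t\<close> derivative of the \<open>w\<close> derivative \<open>A W\<close>.\<close>

lemma ode_solution_series:
  fixes a :: "nat \<Rightarrow> complex \<Rightarrow> complex^'n^'n"
  assumes T: "open T" and hol: "\<And>j i l. (\<lambda>t. a j t $ i $ l) holomorphic_on T"
    and bound: "\<And>j i l t. t \<in> T \<Longrightarrow> norm (a j t $ i $ l) \<le> M * \<rho> ^ j"
    and M: "0 \<le> M" and \<rho>: "0 < \<rho>"
  defines "A \<equiv> \<lambda>t. power_series_matrix (\<lambda>j. a j t)"
  shows "\<exists>\<epsilon>>0. \<exists>W W1. \<forall>t\<in>T. W t 0 = mat 1 \<and> W1 t 0 = 0 \<and>
    (\<forall>w. norm w < \<epsilon> \<longrightarrow> has_matrix_derivative (W t) (A t w ** W t w) w \<and>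
      has_matrix_derivative (\<lambda>t. W t w) (W1 t w) t \<and>
      (\<exists>D. has_matrix_derivative (W1 t) D w \<and> has_matrix_derivative (\<lambda>t. A t w ** W t w) D t))"
proof -
  define L where "L = \<rho> + M * CARD('n)"
  have L: "\<rho> \<le> L" "M * CARD('n) \<le> L" "0 < L"
    using M \<rho> by (auto simp: L_def add_pos_nonneg)
  define c where "c k i l t = ode_coeff (\<lambda>j. a j t) k $ i $ l" for k i l t
  have c_hol: "c k i l holomorphic_on T" for k i l
    unfolding c_def by (rule ode_coeff_holomorphic[OF hol])
  have c_bound: "norm (c k i l t) \<le> 1 * L ^ k" if "t \<in> T" for k i l t
    using ode_coeff_bound[OF bound M \<rho> L(1,2)] that by (simp add: c_def)
  define W where "W t = power_series_matrix (ode_coeff (\<lambda>j. a j t))" for t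
  define W1 where "W1 t w = (\<chi> i l. \<Sum>k. deriv (c k i l) t * w ^ k)" for t w
  define D where "D t w = (\<chi> i l. \<Sum>k. diffs (\<lambda>k. deriv (c k i l) t) k * w ^ k)" for t w
  have W_eq: "W t w $ i $ l = (\<Sum>k. c k i l t * w ^ k)" for t w i l
    by (simp add: W_def power_series_matrix_def c_def)
  have AW: "(A t w ** W t w) $ i $ l = (\<Sum>k. diffs (\<lambda>k. c k i l t) k * w ^ k)"
    if "t \<in> T" "norm w < 1 / (2 * L)" for t w :: complex and i l
    unfolding A_def W_def c_def
    by (rule ode_series_identity[OF bound M \<rho> L(1,2)], use that in simp)
      (rule less_le_trans[OF that(2)], use L in \<open>simp add: field_simps\<close>)
  note mixed = power_series_mixed_derivs[where c = "\<lambda>k. c k i l" for i l, OF T c_hol c_bound L(3)]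
  show ?thesis
  proof (rule exI[of _ "1 / (2 * L)"], rule conjI, use L in simp,
      rule exI[of _ W], rule exI[of _ W1], intro conjI ballI allI impI)
    show "W t 0 = mat 1" for t by (simp add: W_def)
    have "deriv (c 0 i l) t = 0" for i l t
      unfolding c_def by simp
    then show "W1 t 0 = 0" for t
      by (simp add: W1_def vec_eq_iff powser_zero)
    fix t and w :: complex assume t: "t \<in> T" and w: "norm w < 1 / (2 * L)"
    show "has_matrix_derivative (W t) (A t w ** W t w) w"
      unfolding has_matrix_derivative_def W_eq AW[OF t w] using mixed(2)[OF _ w t] by auto
    show "has_matrix_derivative (\<lambda>t. W t w) (W1 t w) t"
      unfolding has_matrix_derivative_def W_eq W1_def using mixed(1)[OF _ w t] by auto
    have "has_matrix_derivative (W1 t) (D t w) w"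
      unfolding has_matrix_derivative_def D_def W1_def using mixed(3)[OF _ w t] by auto
    moreover have "has_matrix_derivative (\<lambda>t. \<chi> i l. \<Sum>k. diffs (\<lambda>k. c k i l t) k * w ^ k) (D t w) t"
      unfolding has_matrix_derivative_def D_def using mixed(4)[OF _ w t] by auto
    then have "has_matrix_derivative (\<lambda>t. A t w ** W t w) (D t w) t"
      by (rule has_matrix_derivative_cong[OF _ T t]) (simp add: vec_eq_iff AW w)
    ultimately show "\<exists>D. has_matrix_derivative (W1 t) D w \<and> has_matrix_derivative (\<lambda>t. A t w ** W t w) D t"
      by blast
  qed
qed

lemma matrix_minus_mult: "(- A) ** (B :: 'a::ring_1^'n^'m) = - (A ** B)"
  by (simp add: matrix_matrix_mult_def vec_eq_iff sum_negf)

lemma matrix_mult_minus: "A ** (- B :: 'a::ring_1^'n^'m) = - (A ** B)"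
  by (simp add: matrix_matrix_mult_def vec_eq_iff sum_negf)

text \<open>\<open>(X V)' = - X A V + X A V = 0\<close>.  Uniqueness of solutions is always drawn from this identity, with an
  inverse \<open>X\<close> of a fundamental solution.\<close>

lemma inverse_solution_constant:
  fixes X V :: "complex \<Rightarrow> complex^'n^'n"
  assumes S: "convex S" "open S"
    and X: "\<And>w. w \<in> S \<Longrightarrow> has_matrix_derivative X (- (X w ** A w)) w"
    and V: "\<And>w. w \<in> S \<Longrightarrow> has_matrix_derivative V (A w ** V w) w"
    and w: "w \<in> S" "w' \<in> S"
  shows "X w ** V w = X w' ** V w'"
proof (rule has_matrix_derivative_zero_constant[OF S _ w, where F = "\<lambda>w. X w ** V w"])
  fix u assume "u \<in> S"
  from has_matrix_derivative_mult[OF X[OF this] V[OF this]]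
  show "has_matrix_derivative (\<lambda>w. X w ** V w) 0 u"
    by (simp add: matrix_mul_assoc matrix_minus_mult)
qed

text \<open>A fundamental solution together with its inverse.  The inverse is itself constructed as a power
  series, namely as the transpose of the solution of the adjoint equation with matrix \<open>- transpose A\<close>;
  so it comes with its derivatives in both variables.\<close>

lemma ode_frame:
  fixes a :: "nat \<Rightarrow> complex \<Rightarrow> complex^'n^'n"
  assumes T: "open T" and hol: "\<And>j i l. (\<lambda>t. a j t $ i $ l) holomorphic_on T"
    and bound: "\<And>j i l t. t \<in> T \<Longrightarrow> norm (a j t $ i $ l) \<le> M * \<rho> ^ j"
    and M: "0 \<le> M" and \<rho>: "0 < \<rho>"
  defines "A \<equiv> \<lambda>t. power_series_matrix (\<lambda>j. a j t)"
  shows "\<exists>\<epsilon>>0. \<exists>W W1 X X1. \<forall>t\<in>T. W t 0 = mat 1 \<and> W1 t 0 = 0 \<and>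
    (\<forall>w. norm w < \<epsilon> \<longrightarrow> X t w ** W t w = mat 1 \<and>
      has_matrix_derivative (W t) (A t w ** W t w) w \<and>
      has_matrix_derivative (X t) (- (X t w ** A t w)) w \<and>
      has_matrix_derivative (\<lambda>t. W t w) (W1 t w) t \<and>
      has_matrix_derivative (\<lambda>t. X t w) (X1 t w) t \<and>
      (\<exists>D. has_matrix_derivative (W1 t) D w \<and> has_matrix_derivative (\<lambda>t. A t w ** W t w) D t))"
proof -
  define a' where "a' j t = - transpose (a j t)" for j t
  have hol': "(\<lambda>t. a' j t $ i $ l) holomorphic_on T" for j i l
    using holomorphic_on_minus[OF hol[of j l i]] by (simp add: a'_def transpose_def)
  have bound': "norm (a' j t $ i $ l) \<le> M * \<rho> ^ j" if "t \<in> T" for j i l t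
    using bound[OF that, of j l i] by (simp add: a'_def transpose_def)
  define A' where "A' t = power_series_matrix (\<lambda>j. a' j t)" for t
  have A': "A' t w = - transpose (A t w)" if "t \<in> T" "norm w < 1 / \<rho>" for t w
    using summable_norm_cancel[OF summable_power_bound[OF bound[OF that(1)] \<rho> that(2)]]
    by (simp add: A'_def A_def a'_def power_series_matrix_def transpose_def vec_eq_iff suminf_minus)
  obtain \<epsilon>1 :: real and W W1 where W: "0 < \<epsilon>1"
    "\<And>t. t \<in> T \<Longrightarrow> W t 0 = mat 1" "\<And>t. t \<in> T \<Longrightarrow> W1 t 0 = 0"
    "\<And>t w. t \<in> T \<Longrightarrow> norm w < \<epsilon>1 \<Longrightarrow> has_matrix_derivative (W t) (A t w ** W t w) w"
    "\<And>t w. t \<in> T \<Longrightarrow> norm w < \<epsilon>1 \<Longrightarrow> has_matrix_derivative (\<lambda>t. W t w) (W1 t w) t"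
    "\<And>t w. t \<in> T \<Longrightarrow> norm w < \<epsilon>1 \<Longrightarrow>
      \<exists>D. has_matrix_derivative (W1 t) D w \<and> has_matrix_derivative (\<lambda>t. A t w ** W t w) D t"
    using ode_solution_series[OF T hol bound M \<rho>] unfolding A_def by blast
  obtain \<epsilon>2 :: real and Y Y1 where Y: "0 < \<epsilon>2"
    "\<And>t. t \<in> T \<Longrightarrow> Y t 0 = mat 1"
    "\<And>t w. t \<in> T \<Longrightarrow> norm w < \<epsilon>2 \<Longrightarrow> has_matrix_derivative (Y t) (A' t w ** Y t w) w"
    "\<And>t w. t \<in> T \<Longrightarrow> norm w < \<epsilon>2 \<Longrightarrow> has_matrix_derivative (\<lambda>t. Y t w) (Y1 t w) t"
    using ode_solution_series[OF T hol' bound' M \<rho>] unfolding A'_def by blast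
  define \<epsilon> where "\<epsilon> = min (min \<epsilon>1 \<epsilon>2) (1 / \<rho>)"
  define X where "X t w = transpose (Y t w)" for t w
  have \<epsilon>: "0 < \<epsilon>" using W(1) Y(1) \<rho> by (simp add: \<epsilon>_def)
  have X: "has_matrix_derivative (X t) (- (X t w ** A t w)) w" if "t \<in> T" "norm w < \<epsilon>" for t w
  proof -
    have "transpose (A' t w ** Y t w) = - (X t w ** A t w)"
      using that unfolding matrix_transpose_mul X_def
      by (simp add: A' \<epsilon>_def) (simp add: transpose_def matrix_matrix_mult_def vec_eq_iff sum_negf)
    then show ?thesis
      using has_matrix_derivative_transpose[OF Y(3)[of t w]] that
      unfolding X_def \<epsilon>_def by simp
  qed
  have XW: "X t w ** W t w = mat 1" if "t \<in> T" "norm w < \<epsilon>" for t w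
  proof -
    have "X t w ** W t w = X t 0 ** W t 0"
      by (rule inverse_solution_constant[of "ball 0 \<epsilon>" _ "A t"])
        (use that X W \<epsilon> in \<open>auto simp: \<epsilon>_def\<close>)
    then show ?thesis using W(2) Y(2) that by (simp add: X_def transpose_mat)
  qed
  show ?thesis
  proof (rule exI[of _ \<epsilon>], rule conjI, rule \<epsilon>, rule exI[of _ W], rule exI[of _ W1], rule exI[of _ X],
      rule exI[of _ "\<lambda>t w. transpose (Y1 t w)"], intro conjI ballI allI impI)
    show "W t 0 = mat 1" "W1 t 0 = 0" if "t \<in> T" for t
      using W(2,3) that by blast+
    fix t and w :: complex assume t: "t \<in> T" and w: "norm w < \<epsilon>"
    note w' = w[unfolded \<epsilon>_def min_less_iff_conj]
    show "X t w ** W t w = mat 1"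
      "has_matrix_derivative (X t) (- (X t w ** A t w)) w"
      using XW X t w by blast+
    show "has_matrix_derivative (W t) (A t w ** W t w) w"
      "has_matrix_derivative (\<lambda>t. W t w) (W1 t w) t"
      "\<exists>D. has_matrix_derivative (W1 t) D w \<and> has_matrix_derivative (\<lambda>t. A t w ** W t w) D t"
      using W(4-6)[OF t] w' by blast+
    show "has_matrix_derivative (\<lambda>t. X t w) (transpose (Y1 t w)) t"
      unfolding X_def using Y(4)[OF t] w' by (intro has_matrix_derivative_transpose) blast
  qed
qed

section \<open>Flat frames of an integrable connection\<close>

lemma matrix_diff_mult: "(A - B) ** (C :: 'a::ring_1^'n^'m) = A ** C - B ** C"
  by (simp add: matrix_matrix_mult_def vec_eq_iff sum_subtractf left_diff_distrib)

lemma matrix_mult_diff: "A ** (B - C :: 'a::ring_1^'n^'m) = A ** B - A ** C"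
  by (simp add: matrix_matrix_mult_def vec_eq_iff sum_subtractf right_diff_distrib)

lemma matrix_add_mult: "(A + B) ** (C :: 'a::ring_1^'n^'m) = A ** C + B ** C"
  by (simp add: matrix_matrix_mult_def vec_eq_iff sum.distrib distrib_right)

lemmas matrix_algebra = matrix_minus_mult matrix_mult_minus matrix_diff_mult matrix_mult_diff
  matrix_add_mult matrix_add_ldistrib matrix_mul_assoc

text \<open>Convergence at one point at distance \<open>r / 2\<close> from the centre already bounds the coefficients
  geometrically.\<close>

lemma holomorphic_matrix_power_series:
  fixes G :: "complex \<Rightarrow> complex^'n^'m"
  assumes hol: "\<And>i l. (\<lambda>t. G t $ i $ l) holomorphic_on ball t0 r" and r: "0 < r"
  shows "\<exists>b M \<rho>. 0 \<le> M \<and> 0 < \<rho> \<and> (\<forall>j i l. norm (b j $ i $ l) \<le> M * \<rho> ^ j) \<and>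
    (\<forall>t\<in>ball t0 r. G t = power_series_matrix b (t - t0))"
proof -
  define b where "b j = (\<chi> i l. (deriv ^^ j) (\<lambda>t. G t $ i $ l) t0 / fact j)" for j
  have sums: "(\<lambda>j. b j $ i $ l * (t - t0) ^ j) sums (G t $ i $ l)" if "t \<in> ball t0 r" for t i l
    using holomorphic_power_series[OF hol that] by (simp add: b_def)
  have "\<exists>K. \<forall>j. norm (b j $ i $ l * of_real (r / 2) ^ j) \<le> K" for i l
  proof -
    have "t0 + of_real (r / 2) \<in> ball t0 r"
      using r by (simp add: dist_norm)
    from sums_summable[OF sums[OF this, of i l]] show ?thesis
      using summable_imp_Bseq by (force simp: Bseq_def)
  qed
  then obtain K where K: "\<And>i l j. norm (b j $ i $ l * of_real (r / 2) ^ j) \<le> K i l"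
    by metis
  define M where "M = (\<Sum>i\<in>UNIV. \<Sum>l\<in>UNIV. \<bar>K i l\<bar>)"
  have KM: "K i l \<le> M" for i l
  proof -
    have "K i l \<le> \<bar>K i l\<bar>" by simp
    also have "\<dots> \<le> (\<Sum>l\<in>UNIV. \<bar>K i l\<bar>)" by (rule member_le_sum) auto
    also have "\<dots> \<le> M" unfolding M_def
      by (rule member_le_sum[where f = "\<lambda>i. \<Sum>l\<in>UNIV. \<bar>K i l\<bar>"]) (auto simp: sum_nonneg)
    finally show ?thesis .
  qed
  have "norm (b j $ i $ l) \<le> M * (2 / r) ^ j" for j i l
    using order_trans[OF K KM, of j i l] r
    by (simp add: norm_mult norm_power norm_divide field_simps power_divide)
  moreover have "G t = power_series_matrix b (t - t0)" if "t \<in> ball t0 r" for t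
    using sums[OF that] by (simp add: power_series_matrix_def vec_eq_iff sums_iff)
  moreover have "0 \<le> M" by (simp add: M_def sum_nonneg)
  ultimately show ?thesis using r
    by (intro exI[of _ b] exI[of _ M] exI[of _ "2 / r"]) auto
qed

text \<open>A fundamental solution \<open>\<Phi>\<close>, with inverse \<open>\<Xi>\<close>, of the system \<open>\<partial>\<Phi>/\<partial>z = A \<Phi>\<close>, \<open>\<partial>\<Phi>/\<partial>t = \<Omega> \<Phi>\<close> on a
  product of two disks.  Only partial derivatives are required: they suffice for uniqueness, since two
  points of a product of disks are joined by moving one coordinate at a time.\<close>

definition flat_frame ::
  "(complex \<Rightarrow> complex \<Rightarrow> complex^'n^'n) \<Rightarrow> (complex \<Rightarrow> complex \<Rightarrow> complex^'n^'n) \<Rightarrow>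
   complex \<Rightarrow> complex \<Rightarrow> real \<Rightarrow> (complex \<Rightarrow> complex \<Rightarrow> complex^'n^'n) \<Rightarrow> (complex \<Rightarrow> complex \<Rightarrow> complex^'n^'n) \<Rightarrow> bool"
where
  "flat_frame A \<Omega> t0 z0 e \<Phi> \<Xi> \<longleftrightarrow> (\<forall>t\<in>ball t0 e. \<forall>z\<in>ball z0 e.
     \<Xi> t z ** \<Phi> t z = mat 1 \<and>
     has_matrix_derivative (\<Phi> t) (A t z ** \<Phi> t z) z \<and>
     has_matrix_derivative (\<lambda>t. \<Phi> t z) (\<Omega> t z ** \<Phi> t z) t \<and>
     has_matrix_derivative (\<Xi> t) (- (\<Xi> t z ** A t z)) z \<and>
     has_matrix_derivative (\<lambda>t. \<Xi> t z) (- (\<Xi> t z ** \<Omega> t z)) t)"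

text \<open>The theorem of Frobenius for a linear connection.  Let \<open>W\<close> solve the \<open>z\<close> equation for each \<open>t\<close>, with
  value \<open>mat 1\<close> at \<open>z0\<close>, and let \<open>V\<close> solve the \<open>t\<close> equation along \<open>z = z0\<close>; the frame is \<open>W V\<close>.
  The defect \<open>Q = \<partial>W/\<partial>t - \<Omega> W + W \<Omega>(t, z0)\<close> of the \<open>t\<close> equation vanishes at \<open>z0\<close>, and zero curvature
  says precisely that it satisfies the \<open>z\<close> equation again.  Hence \<open>Q = 0\<close>.\<close>

lemma flat_frame_exists:
  fixes A \<Omega> :: "complex \<Rightarrow> complex \<Rightarrow> complex^'n^'n" and a :: "nat \<Rightarrow> complex \<Rightarrow> complex^'n^'n"
  assumes r: "0 < r" and hol: "\<And>j i l. (\<lambda>t. a j t $ i $ l) holomorphic_on ball t0 r"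
    and bound: "\<And>j i l t. t \<in> ball t0 r \<Longrightarrow> norm (a j t $ i $ l) \<le> M * \<rho> ^ j"
    and M: "0 \<le> M" and \<rho>: "0 < \<rho>"
    and A: "\<And>t z. t \<in> ball t0 r \<Longrightarrow> z \<in> ball z0 r \<Longrightarrow> A t z = power_series_matrix (\<lambda>j. a j t) (z - z0)"
    and \<Omega>: "\<And>i l. (\<lambda>t. \<Omega> t z0 $ i $ l) holomorphic_on ball t0 r"
    and flat: "\<And>t z. t \<in> ball t0 r \<Longrightarrow> z \<in> ball z0 r \<Longrightarrow>
      \<exists>At \<Omega>z. has_matrix_derivative (\<lambda>t. A t z) At t \<and> has_matrix_derivative (\<Omega> t) \<Omega>z z \<and>
        At + A t z ** \<Omega> t z = \<Omega>z + \<Omega> t z ** A t z"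
  shows "\<exists>e>0. \<exists>\<Phi> \<Xi>. flat_frame A \<Omega> t0 z0 e \<Phi> \<Xi>"
proof -
  obtain \<epsilon>1 :: real and W W1 X X1 where \<epsilon>1: "0 < \<epsilon>1" and W: "\<forall>t\<in>ball t0 r. W t 0 = mat 1 \<and> W1 t 0 = 0 \<and>
    (\<forall>w. norm w < \<epsilon>1 \<longrightarrow> X t w ** W t w = mat 1 \<and>
      has_matrix_derivative (W t) (power_series_matrix (\<lambda>j. a j t) w ** W t w) w \<and>
      has_matrix_derivative (X t) (- (X t w ** power_series_matrix (\<lambda>j. a j t) w)) w \<and>
      has_matrix_derivative (\<lambda>t. W t w) (W1 t w) t \<and>
      has_matrix_derivative (\<lambda>t. X t w) (X1 t w) t \<and>
      (\<exists>D. has_matrix_derivative (W1 t) D w \<and>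
         has_matrix_derivative (\<lambda>t. power_series_matrix (\<lambda>j. a j t) w ** W t w) D t))"
    using ode_frame[OF open_ball hol bound M \<rho>] by blast
  obtain b M' \<rho>' where b: "0 \<le> M'" "0 < \<rho>'" "\<And>j i l. norm (b j $ i $ l) \<le> M' * \<rho>' ^ j"
    "\<And>t. t \<in> ball t0 r \<Longrightarrow> \<Omega> t z0 = power_series_matrix b (t - t0)"
    using holomorphic_matrix_power_series[of "\<lambda>t. \<Omega> t z0", OF \<Omega> r] by blast
  obtain \<epsilon>2 :: real and V0 V1 Y0 Y1 where \<epsilon>2: "0 < \<epsilon>2" and V: "\<forall>t\<in>UNIV.
    V0 t 0 = mat 1 \<and> V1 t 0 = 0 \<and>
    (\<forall>w. norm w < \<epsilon>2 \<longrightarrow> Y0 t w ** V0 t w = mat 1 \<and>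
      has_matrix_derivative (V0 t) (power_series_matrix b w ** V0 t w) w \<and>
      has_matrix_derivative (Y0 t) (- (Y0 t w ** power_series_matrix b w)) w \<and>
      has_matrix_derivative (\<lambda>t. V0 t w) (V1 t w) t \<and>
      has_matrix_derivative (\<lambda>t. Y0 t w) (Y1 t w) t \<and>
      (\<exists>D. has_matrix_derivative (V1 t) D w \<and>
         has_matrix_derivative (\<lambda>t. power_series_matrix b w ** V0 t w) D t))"
    using ode_frame[of UNIV "\<lambda>j t. b j", OF open_UNIV holomorphic_on_const b(3) b(1) b(2)] by blast
  define V Y where "V t = V0 0 (t - t0)" and "Y t = Y0 0 (t - t0)" for t
  define e where "e = min r (min \<epsilon>1 \<epsilon>2)"
  have e: "0 < e" "e \<le> r" "e \<le> \<epsilon>1" "e \<le> \<epsilon>2"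
    using r \<epsilon>1 \<epsilon>2 by (auto simp: e_def)
  have YV: "Y t ** V t = mat 1" "has_matrix_derivative V (\<Omega> t z0 ** V t) t"
    "has_matrix_derivative Y (- (Y t ** \<Omega> t z0)) t" if "t \<in> ball t0 e" for t
  proof -
    have *: "norm (t - t0) < \<epsilon>2" "t \<in> ball t0 r"
      using that e by (auto simp: dist_norm norm_minus_commute)
    show "Y t ** V t = mat 1" using V * by (simp add: V_def Y_def)
    show "has_matrix_derivative V (\<Omega> t z0 ** V t) t"
      unfolding V_def b(4)[OF *(2)] by (rule has_matrix_derivative_shift) (use V * in blast)
    show "has_matrix_derivative Y (- (Y t ** \<Omega> t z0)) t"
      unfolding Y_def b(4)[OF *(2)] by (rule has_matrix_derivative_shift) (use V * in blast)
  qed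
  have XW: "X t (z - z0) ** W t (z - z0) = mat 1"
    "W t (z - z0) ** X t (z - z0) = mat 1"
    "has_matrix_derivative (\<lambda>z. W t (z - z0)) (A t z ** W t (z - z0)) z"
    "has_matrix_derivative (\<lambda>z. X t (z - z0)) (- (X t (z - z0) ** A t z)) z"
    "has_matrix_derivative (\<lambda>t. W t (z - z0)) (W1 t (z - z0)) t"
    "has_matrix_derivative (\<lambda>t. X t (z - z0)) (X1 t (z - z0)) t"
    "\<exists>D. has_matrix_derivative (\<lambda>z. W1 t (z - z0)) D z \<and>
         has_matrix_derivative (\<lambda>t. A t z ** W t (z - z0)) D t"
    if t: "t \<in> ball t0 e" and z: "z \<in> ball z0 e" for t z
  proof -
    have *: "norm (z - z0) < \<epsilon>1" "z \<in> ball z0 r" "t \<in> ball t0 r"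
      using t z e by (auto simp: dist_norm norm_minus_commute)
    note W' = bspec[OF W *(3), THEN conjunct2, THEN conjunct2, rule_format, OF *(1)]
    show 1: "X t (z - z0) ** W t (z - z0) = mat 1"
      using W' by blast
    show "W t (z - z0) ** X t (z - z0) = mat 1"
      using 1 by (simp add: matrix_left_right_inverse)
    show "has_matrix_derivative (\<lambda>z. W t (z - z0)) (A t z ** W t (z - z0)) z"
      "has_matrix_derivative (\<lambda>z. X t (z - z0)) (- (X t (z - z0) ** A t z)) z"
      unfolding A[OF *(3,2)] by (rule has_matrix_derivative_shift; use W' in blast)+
    show "has_matrix_derivative (\<lambda>t. W t (z - z0)) (W1 t (z - z0)) t"
      "has_matrix_derivative (\<lambda>t. X t (z - z0)) (X1 t (z - z0)) t"
      using W' by blast+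
    from W' obtain D where D: "has_matrix_derivative (W1 t) D (z - z0)"
      "has_matrix_derivative (\<lambda>t. power_series_matrix (\<lambda>j. a j t) (z - z0) ** W t (z - z0)) D t"
      by blast
    have "has_matrix_derivative (\<lambda>t. A t z ** W t (z - z0)) D t"
      by (rule has_matrix_derivative_cong[OF D(2) open_ball *(3)]) (simp add: A *(2) del: mem_ball)
    with has_matrix_derivative_shift[OF D(1)]
    show "\<exists>D. has_matrix_derivative (\<lambda>z. W1 t (z - z0)) D z \<and>
         has_matrix_derivative (\<lambda>t. A t z ** W t (z - z0)) D t"
      by blast
  qed
  have W1: "W1 t (z - z0) = \<Omega> t z ** W t (z - z0) - W t (z - z0) ** \<Omega> t z0"
    if t: "t \<in> ball t0 e" and z: "z \<in> ball z0 e" for t z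
  proof -
    define Q where "Q z = W1 t (z - z0) - \<Omega> t z ** W t (z - z0) + W t (z - z0) ** \<Omega> t z0" for z
    have z0: "z0 \<in> ball z0 e" using e by simp
    have Q: "has_matrix_derivative Q (A t u ** Q u) u" if u: "u \<in> ball z0 e" for u
    proof -
      obtain At \<Omega>z where At: "has_matrix_derivative (\<lambda>t. A t u) At t"
        and \<Omega>z: "has_matrix_derivative (\<Omega> t) \<Omega>z u"
        and zc: "At + A t u ** \<Omega> t u = \<Omega>z + \<Omega> t u ** A t u"
        using flat[of t u] t u e by auto
      obtain D where D: "has_matrix_derivative (\<lambda>z. W1 t (z - z0)) D u"
        "has_matrix_derivative (\<lambda>t. A t u ** W t (u - z0)) D t"
        using XW(7)[OF t u] by blast
      have D_eq: "D = At ** W t (u - z0) + A t u ** W1 t (u - z0)"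
        by (rule has_matrix_derivative_unique[OF D(2) has_matrix_derivative_mult[OF At XW(5)[OF t u]]])
      have "has_matrix_derivative Q (D - (\<Omega>z ** W t (u - z0) + \<Omega> t u ** (A t u ** W t (u - z0)))
          + (A t u ** W t (u - z0) ** \<Omega> t z0 + W t (u - z0) ** 0)) u"
        unfolding Q_def
        by (intro has_matrix_derivative_add has_matrix_derivative_diff has_matrix_derivative_mult
            has_matrix_derivative_const D(1) \<Omega>z XW(3)[OF t u])
      also have "D - (\<Omega>z ** W t (u - z0) + \<Omega> t u ** (A t u ** W t (u - z0)))
          + (A t u ** W t (u - z0) ** \<Omega> t z0 + W t (u - z0) ** 0) = A t u ** Q u"
        using arg_cong[OF zc, of "\<lambda>M. M ** W t (u - z0)"]
        by (simp add: D_eq Q_def matrix_algebra algebra_simps)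
      finally show ?thesis .
    qed
    have "X t (z - z0) ** Q z = X t (z0 - z0) ** Q z0"
      by (rule inverse_solution_constant[OF convex_ball open_ball XW(4)[OF t] Q z z0])
    also have "Q z0 = 0"
      using W t e(2) by (simp add: Q_def matrix_algebra)
    finally have "W t (z - z0) ** (X t (z - z0) ** Q z) = 0"
      by (simp add: matrix_algebra)
    then have "Q z = 0"
      by (simp add: matrix_mul_assoc XW(2)[OF t z])
    then show ?thesis by (simp add: Q_def algebra_simps)
  qed
  have X1: "X1 t (z - z0) = \<Omega> t z0 ** X t (z - z0) - X t (z - z0) ** \<Omega> t z"
    if t: "t \<in> ball t0 e" and z: "z \<in> ball z0 e" for t z
  proof -
    have "has_matrix_derivative (\<lambda>t. X t (z - z0) ** W t (z - z0))
        (X1 t (z - z0) ** W t (z - z0) + X t (z - z0) ** W1 t (z - z0)) t"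
      by (rule has_matrix_derivative_mult[OF XW(6,5)[OF t z]])
    moreover have "has_matrix_derivative (\<lambda>t. X t (z - z0) ** W t (z - z0)) 0 t"
      by (rule has_matrix_derivative_cong[OF has_matrix_derivative_const[of "mat 1"] open_ball t])
        (use XW(1)[OF _ z] in simp)
    ultimately have "X1 t (z - z0) ** W t (z - z0) + X t (z - z0) ** W1 t (z - z0) = 0"
      by (rule has_matrix_derivative_unique)
    then have "X1 t (z - z0) ** W t (z - z0) = - (X t (z - z0) ** W1 t (z - z0))"
      by (simp add: eq_neg_iff_add_eq_0)
    then have "X1 t (z - z0) ** W t (z - z0) ** X t (z - z0)
        = - (X t (z - z0) ** W1 t (z - z0)) ** X t (z - z0)"
      by simp
    then have "X1 t (z - z0) ** (W t (z - z0) ** X t (z - z0))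
        = - (X t (z - z0) ** \<Omega> t z ** (W t (z - z0) ** X t (z - z0)))
          + (X t (z - z0) ** W t (z - z0)) ** \<Omega> t z0 ** X t (z - z0)"
      by (simp add: W1[OF t z] matrix_algebra)
    then show ?thesis
      by (simp only: XW(1,2)[OF t z] matrix_mul_lid matrix_mul_rid) simp
  qed
  define \<Phi> where "\<Phi> t z = W t (z - z0) ** V t" for t z
  define \<Xi> where "\<Xi> t z = Y t ** X t (z - z0)" for t z
  have "flat_frame A \<Omega> t0 z0 e \<Phi> \<Xi>"
    unfolding flat_frame_def
  proof (intro ballI conjI)
    fix t z assume t: "t \<in> ball t0 e" and z: "z \<in> ball z0 e"
    have "\<Xi> t z ** \<Phi> t z = Y t ** (X t (z - z0) ** W t (z - z0)) ** V t"
      by (simp add: \<Phi>_def \<Xi>_def matrix_mul_assoc)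
    then show "\<Xi> t z ** \<Phi> t z = mat 1"
      by (simp add: XW(1)[OF t z] YV(1)[OF t])
    show "has_matrix_derivative (\<Phi> t) (A t z ** \<Phi> t z) z"
      using has_matrix_derivative_mult[OF XW(3)[OF t z] has_matrix_derivative_const[of "V t"]]
      by (simp add: \<Phi>_def[abs_def] matrix_algebra)
    show "has_matrix_derivative (\<Xi> t) (- (\<Xi> t z ** A t z)) z"
      using has_matrix_derivative_mult[OF has_matrix_derivative_const[of "Y t"] XW(4)[OF t z]]
      by (simp add: \<Xi>_def[abs_def] matrix_algebra)
    show "has_matrix_derivative (\<lambda>t. \<Phi> t z) (\<Omega> t z ** \<Phi> t z) t"
      using has_matrix_derivative_mult[OF XW(5)[OF t z] YV(2)[OF t]]
      by (simp add: \<Phi>_def[abs_def] W1[OF t z] matrix_algebra)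
    show "has_matrix_derivative (\<lambda>t. \<Xi> t z) (- (\<Xi> t z ** \<Omega> t z)) t"
      using has_matrix_derivative_mult[OF YV(3)[OF t] XW(6)[OF t z]]
      by (simp add: \<Xi>_def[abs_def] X1[OF t z] matrix_algebra)
  qed
  with e(1) show ?thesis by blast
qed

lemma flat_frame_compare:
  assumes F: "flat_frame A \<Omega> t0 z0 e \<Phi> \<Xi>" and G: "flat_frame A \<Omega> t1 z1 e' \<Phi>' \<Xi>'"
    and d: "0 < d" "ball t2 d \<subseteq> ball t0 e \<inter> ball t1 e'" "ball z2 d \<subseteq> ball z0 e \<inter> ball z1 e'"
  shows "\<exists>K. \<forall>t\<in>ball t2 d. \<forall>z\<in>ball z2 d. \<Phi>' t z = \<Phi> t z ** K"
proof -
  have \<Xi>: "has_matrix_derivative (\<Xi> t) (- (\<Xi> t z ** A t z)) z"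
    "has_matrix_derivative (\<lambda>t. \<Xi> t z) (- (\<Xi> t z ** \<Omega> t z)) t"
    and \<Phi>': "has_matrix_derivative (\<Phi>' t) (A t z ** \<Phi>' t z) z"
    "has_matrix_derivative (\<lambda>t. \<Phi>' t z) (\<Omega> t z ** \<Phi>' t z) t"
    if "t \<in> ball t2 d" "z \<in> ball z2 d" for t z
  proof -
    from that d have "t \<in> ball t0 e" "z \<in> ball z0 e" "t \<in> ball t1 e'" "z \<in> ball z1 e'"
      by blast+
    with F G show "has_matrix_derivative (\<Xi> t) (- (\<Xi> t z ** A t z)) z"
      "has_matrix_derivative (\<lambda>t. \<Xi> t z) (- (\<Xi> t z ** \<Omega> t z)) t"
      "has_matrix_derivative (\<Phi>' t) (A t z ** \<Phi>' t z) z"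
      "has_matrix_derivative (\<lambda>t. \<Phi>' t z) (\<Omega> t z ** \<Phi>' t z) t"
      unfolding flat_frame_def by blast+
  qed
  have *: "\<Xi> t z ** \<Phi>' t z = \<Xi> t2 z2 ** \<Phi>' t2 z2" if t: "t \<in> ball t2 d" and z: "z \<in> ball z2 d" for t z
  proof -
    have c: "t2 \<in> ball t2 d" "z2 \<in> ball z2 d" using d(1) by auto
    have "\<Xi> t z ** \<Phi>' t z = \<Xi> t z2 ** \<Phi>' t z2"
      by (rule inverse_solution_constant[OF convex_ball open_ball \<Xi>(1)[OF t] \<Phi>'(1)[OF t] z c(2)])
    also have "\<dots> = \<Xi> t2 z2 ** \<Phi>' t2 z2"
      by (rule inverse_solution_constant[OF convex_ball open_ball \<Xi>(2)[OF _ c(2)] \<Phi>'(2)[OF _ c(2)] t c(1)])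
    finally show ?thesis .
  qed
  show ?thesis
  proof (intro exI ballI)
    fix t z assume t: "t \<in> ball t2 d" and z: "z \<in> ball z2 d"
    have "t \<in> ball t0 e" "z \<in> ball z0 e"
      using t z d by blast+
    then have "\<Xi> t z ** \<Phi> t z = mat 1"
      using F by (simp add: flat_frame_def)
    then have "\<Phi> t z ** \<Xi> t z = mat 1"
      by (simp add: matrix_left_right_inverse)
    then show "\<Phi>' t z = \<Phi> t z ** (\<Xi> t2 z2 ** \<Phi>' t2 z2)"
      unfolding *[OF t z, symmetric] by (simp add: matrix_mul_assoc)
  qed
qed

section \<open>Local systems and parallel sections\<close>

lemma invertible_mult_left_cancel:
  fixes A B C :: "complex^'m^'m"
  assumes "invertible A" "A ** B = A ** C"
  shows "B = C"
proof -
  obtain A' where "A' ** A = mat 1" using assms(1) unfolding invertible_def by blast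
  moreover have "A' ** (A ** B) = A' ** (A ** C)" using assms(2) by simp
  ultimately show ?thesis by (simp add: matrix_mul_assoc)
qed

text \<open>A local system on \<open>S\<close>, given by local frames: \<open>F x\<close> is a frame near \<open>x\<close>, and the frame at a nearby
  point differs from it by a constant matrix.\<close>

locale local_system =
  fixes S :: "'a::metric_space set" and F :: "'a \<Rightarrow> 'a \<Rightarrow> complex^'n^'n"
  assumes frame_invertible: "x \<in> S \<Longrightarrow> \<exists>d>0. \<forall>y. dist y x < d \<longrightarrow> invertible (F x y)"
    and frame_change: "x \<in> S \<Longrightarrow> \<exists>d>0. \<forall>x'\<in>S. dist x' x < d \<longrightarrow>
      (\<exists>K. \<exists>d'>0. \<forall>y. dist y x' < d' \<longrightarrow> F x y = F x' y ** K)"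
begin

text \<open>The pull-back of the local system along \<open>h\<close> has \<open>G\<close> as a matrix of sections.  For a path \<open>h\<close> this is
  analytic continuation along \<open>h\<close>; the case of a square gives its homotopy invariance.\<close>

definition parallel :: "('b::metric_space \<Rightarrow> 'a) \<Rightarrow> 'b set \<Rightarrow> ('b \<Rightarrow> complex^'n^'n) \<Rightarrow> bool" where
  "parallel h R G \<longleftrightarrow> continuous_on R h \<and> h ` R \<subseteq> S \<and>
     (\<forall>p\<in>R. \<exists>K. \<exists>d>0. \<forall>q\<in>R. dist q p < d \<longrightarrow> G q = F (h p) (h q) ** K)"

definition liftable :: "('b::metric_space \<Rightarrow> 'a) \<Rightarrow> 'b set \<Rightarrow> bool" where
  "liftable h R \<longleftrightarrow> (\<exists>G. parallel h R G \<and> (\<forall>p\<in>R. invertible (G p)))"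

lemma parallel_mult:
  assumes "parallel h R G"
  shows "parallel h R (\<lambda>q. G q ** K)"
  unfolding parallel_def
proof (intro conjI ballI)
  fix p assume "p \<in> R"
  with assms obtain K' d where "d > 0" "\<forall>q\<in>R. dist q p < d \<longrightarrow> G q = F (h p) (h q) ** K'"
    unfolding parallel_def by blast
  then show "\<exists>K''. \<exists>d>0. \<forall>q\<in>R. dist q p < d \<longrightarrow> G q ** K = F (h p) (h q) ** K''"
    by (intro exI[of _ "K' ** K"] exI[of _ d]) (auto simp: matrix_mul_assoc)
qed (use assms in \<open>auto simp: parallel_def\<close>)

lemma parallel_compose:
  assumes "parallel h R G" "continuous_on Q k" "k ` Q \<subseteq> R"
  shows "parallel (\<lambda>q. h (k q)) Q (\<lambda>q. G (k q))"
  unfolding parallel_def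
proof (intro conjI ballI)
  show "continuous_on Q (\<lambda>q. h (k q))"
    by (rule continuous_on_compose2[of R h]) (use assms in \<open>auto simp: parallel_def\<close>)
  show "(\<lambda>q. h (k q)) ` Q \<subseteq> S"
    using assms unfolding parallel_def by blast
  fix p assume p: "p \<in> Q"
  with assms obtain K d where d: "d > 0" "\<forall>q\<in>R. dist q (k p) < d \<longrightarrow> G q = F (h (k p)) (h q) ** K"
    unfolding parallel_def by blast
  obtain d' where "d' > 0" "\<forall>q\<in>Q. dist q p < d' \<longrightarrow> dist (k q) (k p) < d"
    using assms(2) p d(1) unfolding continuous_on_iff by blast
  then show "\<exists>K. \<exists>d>0. \<forall>q\<in>Q. dist q p < d \<longrightarrow> G (k q) = F (h (k p)) (h (k q)) ** K"
    using d(2) assms(3) by (intro exI[of _ K] exI[of _ d']) auto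
qed

lemma parallel_subset:
  assumes "parallel h R G" "Q \<subseteq> R"
  shows "parallel h Q G"
  using parallel_compose[OF assms(1) continuous_on_id, of Q] assms(2) by simp

lemma parallel_const:
  assumes "x \<in> S"
  shows "parallel (\<lambda>_. x) R (\<lambda>_. K)"
proof -
  obtain J where "F x x ** J = mat 1"
    using frame_invertible[OF assms] unfolding invertible_def by (metis dist_self)
  then have "K = F x x ** (J ** K)"
    by (simp add: matrix_mul_assoc)
  then show ?thesis
    using assms unfolding parallel_def by (auto intro!: exI[of _ "J ** K"] exI[of _ "1::real"])
qed

lemma parallel_cong:
  assumes "parallel h R G" "\<And>q. q \<in> R \<Longrightarrow> h q = h' q"
  shows "parallel h' R G"
proof -
  have "continuous_on R h'"
    using assms continuous_on_cong[OF refl, of R h h'] by (simp add: parallel_def)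
  then show ?thesis
    using assms unfolding parallel_def by (simp add: image_subset_iff)
qed

lemma parallel_near:
  assumes "parallel h R G" "p \<in> R"
  obtains K d where "d > 0"
    "\<And>q. q \<in> R \<Longrightarrow> dist q p < d \<Longrightarrow> G q = F (h p) (h q) ** K \<and> invertible (F (h p) (h q))"
proof -
  obtain K d where d: "d > 0" "\<And>q. q \<in> R \<Longrightarrow> dist q p < d \<Longrightarrow> G q = F (h p) (h q) ** K"
    using assms unfolding parallel_def by blast
  have "h p \<in> S" and cont: "continuous_on R h" using assms unfolding parallel_def by blast+
  then obtain e where e: "e > 0" "\<And>y. dist y (h p) < e \<Longrightarrow> invertible (F (h p) y)"
    using frame_invertible by blast
  obtain d' where d': "d' > 0" "\<And>q. q \<in> R \<Longrightarrow> dist q p < d' \<Longrightarrow> dist (h q) (h p) < e"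
    using cont assms(2) e(1) unfolding continuous_on_iff by blast
  show thesis
  proof (rule that)
    show "0 < min d d'" using d(1) d'(1) by simp
    fix q assume "q \<in> R" "dist q p < min d d'"
    then show "G q = F (h p) (h q) ** K \<and> invertible (F (h p) (h q))"
      using d(2) d'(2) e(2) by simp
  qed
qed

text \<open>Near a point both matrices are constant multiples of the same invertible frame, so the truth value of
  \<open>G q = G' q\<close> is locally constant.\<close>

lemma parallel_unique:
  assumes G: "parallel h R G" and G': "parallel h R G'" and R: "connected R"
    and p: "p \<in> R" "p' \<in> R" and eq: "G p = G' p"
  shows "G p' = G' p'"
proof -
  have "(G p = G' p) = (G p' = G' p')"
  proof (rule connected_local_const[OF R p], intro ballI)
    fix a assume a: "a \<in> R"
    obtain K d where d: "d > 0"
      "\<And>q. q \<in> R \<Longrightarrow> dist q a < d \<Longrightarrow> G q = F (h a) (h q) ** K \<and> invertible (F (h a) (h q))"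
      using parallel_near[OF G a] by metis
    obtain K' d' where d': "d' > 0"
      "\<And>q. q \<in> R \<Longrightarrow> dist q a < d' \<Longrightarrow> G' q = F (h a) (h q) ** K' \<and> invertible (F (h a) (h q))"
      using parallel_near[OF G' a] by metis
    have *: "(G q = G' q) = (K = K')" if "q \<in> R" "dist q a < min d d'" for q
      using d(2)[of q] d'(2)[of q] that invertible_mult_left_cancel by auto
    show "\<forall>\<^sub>F b in at a within R. (G a = G' a) = (G b = G' b)"
      unfolding eventually_at by (rule exI[of _ "min d d'"]) (use * a d(1) d'(1) in auto)
  qed
  with eq show ?thesis by simp
qed

lemma liftable_normalized:
  assumes "liftable h R" "p0 \<in> R"
  shows "\<exists>G. parallel h R G \<and> (\<forall>p\<in>R. invertible (G p)) \<and> G p0 = mat 1"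
proof -
  obtain G where G: "parallel h R G" "\<forall>p\<in>R. invertible (G p)"
    using assms unfolding liftable_def by blast
  then obtain K where K: "G p0 ** K = mat 1" "K ** G p0 = mat 1"
    using assms(2) unfolding invertible_def by blast
  then have "invertible K" unfolding invertible_def by blast
  with G K show ?thesis
    by (intro exI[of _ "\<lambda>q. G q ** K"]) (auto intro: parallel_mult invertible_mult)
qed

lemma liftable_local:
  assumes "x \<in> S"
  shows "\<exists>d>0. \<forall>(h :: 'b::metric_space \<Rightarrow> 'a) R.
    continuous_on R h \<and> h ` R \<subseteq> S \<inter> ball x d \<longrightarrow> liftable h R"
proof -
  obtain d1 where d1: "d1 > 0" "\<And>y. dist y x < d1 \<Longrightarrow> invertible (F x y)"
    using frame_invertible[OF assms] by blast
  obtain d2 where d2: "d2 > 0" "\<And>x'. x' \<in> S \<Longrightarrow> dist x' x < d2 \<Longrightarrow>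
      \<exists>K. \<exists>d'>0. \<forall>y. dist y x' < d' \<longrightarrow> F x y = F x' y ** K"
    using frame_change[OF assms] by blast
  show ?thesis
  proof (intro exI[of _ "min d1 d2"] conjI allI impI)
    show "0 < min d1 d2" using d1 d2 by simp
    fix h :: "'b \<Rightarrow> 'a" and R
    assume "continuous_on R h \<and> h ` R \<subseteq> S \<inter> ball x (min d1 d2)"
    then have h: "continuous_on R h" "h ` R \<subseteq> S \<inter> ball x (min d1 d2)"
      by auto
    have "parallel h R (\<lambda>q. F x (h q))"
      unfolding parallel_def
    proof (intro conjI ballI h)
      show "h ` R \<subseteq> S" using h by blast
      fix p assume p: "p \<in> R"
      then have "h p \<in> S" "dist (h p) x < d2" using h(2) by (auto simp: dist_commute)
      then obtain K d' where d': "d' > 0" "\<forall>y. dist y (h p) < d' \<longrightarrow> F x y = F (h p) y ** K"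
        using d2 by blast
      moreover obtain d where "d > 0" "\<forall>q\<in>R. dist q p < d \<longrightarrow> dist (h q) (h p) < d'"
        using h(1) p d'(1) unfolding continuous_on_iff by blast
      ultimately show "\<exists>K. \<exists>d>0. \<forall>q\<in>R. dist q p < d \<longrightarrow> F x (h q) = F (h p) (h q) ** K"
        by blast
    qed
    moreover have "invertible (F x (h p))" if "p \<in> R" for p
      using h(2) that by (intro d1(2)) (auto simp: dist_commute)
    ultimately show "liftable h R"
      unfolding liftable_def by blast
  qed
qed

text \<open>Normalised to be \<open>mat 1\<close> at a common point, the two sections agree on the connected intersection.  A point
  of it has the same frame constant from either side, so the union of the sections is parallel there.\<close>

lemma liftable_Un:
  assumes R1: "liftable h R1" "closed R1" and R2: "liftable h R2" "closed R2"
    and conn: "connected (R1 \<inter> R2)" and p0: "p0 \<in> R1 \<inter> R2"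
  shows "liftable h (R1 \<union> R2)"
proof -
  obtain G1 where G1: "parallel h R1 G1" "\<And>p. p \<in> R1 \<Longrightarrow> invertible (G1 p)" "G1 p0 = mat 1"
    using liftable_normalized[OF R1(1)] p0 by blast
  obtain G2 where G2: "parallel h R2 G2" "\<And>p. p \<in> R2 \<Longrightarrow> invertible (G2 p)" "G2 p0 = mat 1"
    using liftable_normalized[OF R2(1)] p0 by blast
  have eq: "G1 p = G2 p" if "p \<in> R1 \<inter> R2" for p
    by (rule parallel_unique[OF parallel_subset[OF G1(1)] parallel_subset[OF G2(1)] conn p0 that])
      (auto simp: G1 G2)
  define G where "G p = (if p \<in> R1 then G1 p else G2 p)" for p
  have G: "p \<in> R1 \<Longrightarrow> G p = G1 p" "p \<in> R2 \<Longrightarrow> G p = G2 p" for p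
    using eq by (auto simp: G_def)
  have cont: "continuous_on (R1 \<union> R2) h"
    using G1(1) G2(1) by (intro continuous_on_closed_Un R1(2) R2(2)) (simp_all add: parallel_def)
  have away: "\<exists>d>0. \<forall>q. dist q p < d \<longrightarrow> q \<notin> Q" if "closed Q" "p \<notin> Q" for p and Q :: "'b set"
    using open_Compl[OF that(1)] that(2) unfolding open_dist by blast
  have local: "\<exists>K. \<exists>d>0. \<forall>q\<in>R1 \<union> R2. dist q p < d \<longrightarrow> G q = F (h p) (h q) ** K"
    if p: "p \<in> R1 \<union> R2" for p
  proof -
    consider "p \<in> R1" "p \<in> R2" | "p \<in> R1" "p \<notin> R2" | "p \<notin> R1" "p \<in> R2"
      using p by blast
    then show ?thesis
    proof cases
      case 1
      obtain K1 d1 where d1: "d1 > 0"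
        "\<And>q. q \<in> R1 \<Longrightarrow> dist q p < d1 \<Longrightarrow> G1 q = F (h p) (h q) ** K1 \<and> invertible (F (h p) (h q))"
        using parallel_near[OF G1(1) 1(1)] by metis
      obtain K2 d2 where d2: "d2 > 0"
        "\<And>q. q \<in> R2 \<Longrightarrow> dist q p < d2 \<Longrightarrow> G2 q = F (h p) (h q) ** K2 \<and> invertible (F (h p) (h q))"
        using parallel_near[OF G2(1) 1(2)] by metis
      have inv: "invertible (F (h p) (h p))" and eq1: "G1 p = F (h p) (h p) ** K1"
        using d1(2)[OF 1(1)] d1(1) by simp_all
      have "F (h p) (h p) ** K1 = F (h p) (h p) ** K2"
        unfolding eq1[symmetric] using d2(2)[OF 1(2)] d2(1) eq[of p] 1 by simp
      with inv have "K1 = K2" by (rule invertible_mult_left_cancel)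
      show ?thesis
      proof (intro exI[of _ K1] exI[of _ "min d1 d2"] conjI ballI impI)
        show "0 < min d1 d2" using d1(1) d2(1) by simp
        fix q assume "q \<in> R1 \<union> R2" "dist q p < min d1 d2"
        then show "G q = F (h p) (h q) ** K1"
          using d1(2)[of q] d2(2)[of q] G[of q] \<open>K1 = K2\<close> unfolding Un_iff min_less_iff_conj by metis
      qed
    next
      case 2
      obtain K1 d1 where d1: "d1 > 0"
        "\<And>q. q \<in> R1 \<Longrightarrow> dist q p < d1 \<Longrightarrow> G1 q = F (h p) (h q) ** K1 \<and> invertible (F (h p) (h q))"
        using parallel_near[OF G1(1) 2(1)] by metis
      obtain d where d: "d > 0" "\<forall>q. dist q p < d \<longrightarrow> q \<notin> R2"
        using away[OF R2(2) 2(2)] by blast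
      show ?thesis
      proof (intro exI[of _ K1] exI[of _ "min d1 d"] conjI ballI impI)
        show "0 < min d1 d" using d1(1) d(1) by simp
        fix q assume "q \<in> R1 \<union> R2" "dist q p < min d1 d"
        then have "q \<in> R1" "dist q p < d1" using d(2) by auto
        then show "G q = F (h p) (h q) ** K1"
          using d1(2) G(1) by metis
      qed
    next
      case 3
      obtain K2 d2 where d2: "d2 > 0"
        "\<And>q. q \<in> R2 \<Longrightarrow> dist q p < d2 \<Longrightarrow> G2 q = F (h p) (h q) ** K2 \<and> invertible (F (h p) (h q))"
        using parallel_near[OF G2(1) 3(2)] by metis
      obtain d where d: "d > 0" "\<forall>q. dist q p < d \<longrightarrow> q \<notin> R1"
        using away[OF R1(2) 3(1)] by blast
      show ?thesis
      proof (intro exI[of _ K2] exI[of _ "min d2 d"] conjI ballI impI)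
        show "0 < min d2 d" using d2(1) d(1) by simp
        fix q assume "q \<in> R1 \<union> R2" "dist q p < min d2 d"
        then have "q \<in> R2" "dist q p < d2" using d(2) by auto
        then show "G q = F (h p) (h q) ** K2"
          using d2(2) G(2) by metis
      qed
    qed
  qed
  have "parallel h (R1 \<union> R2) G"
    using cont G1(1) G2(1) local unfolding parallel_def image_Un by simp
  moreover have "invertible (G p)" if "p \<in> R1 \<union> R2" for p
    using that G1(2) G2(2) by (auto simp: G_def)
  ultimately show ?thesis
    unfolding liftable_def by blast
qed

text \<open>Bisection of the second coordinate; the width \<open>\<delta>\<close> of the strip around \<open>u\<close> must be chosen along the way,
  and shrinks whenever two pieces are glued.\<close>

lemma liftable_strip:
  fixes h :: "real \<times> real \<Rightarrow> 'a"
  assumes h: "continuous_on ({0..1} \<times> {0..1}) h" "h ` ({0..1} \<times> {0..1}) \<subseteq> S" and u: "u \<in> {0..1}"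
  shows "\<exists>\<delta>>0. \<forall>c d. c \<le> u \<and> u \<le> d \<and> d - c < \<delta> \<longrightarrow> liftable h (({c..d} \<inter> {0..1}) \<times> {0..1})"
proof -
  define P where "P a b \<longleftrightarrow> 0 \<le> a \<and> b \<le> 1 \<longrightarrow> (\<exists>\<delta>>0. \<forall>c d. c \<le> u \<and> u \<le> d \<and> d - c < \<delta> \<longrightarrow>
      liftable h (({c..d} \<inter> {0..1}) \<times> {a..b}))" for a b :: real
  have "P 0 1"
  proof (rule Bolzano[of 0 1 P])
    show "(0::real) \<le> 1" by simp
  next
    fix a b c :: real
    assume trans: "P a b" "P b c" "a \<le> b" "b \<le> c"
    show "P a c" unfolding P_def
    proof (intro impI)
      assume ac: "0 \<le> a \<and> c \<le> 1"
      then have b: "0 \<le> b" "b \<le> 1" using trans by auto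
      obtain \<delta>1 where \<delta>1: "\<delta>1 > 0" "\<And>c' d. c' \<le> u \<and> u \<le> d \<and> d - c' < \<delta>1 \<Longrightarrow>
          liftable h (({c'..d} \<inter> {0..1}) \<times> {a..b})"
        using trans(1) ac b unfolding P_def by blast
      obtain \<delta>2 where \<delta>2: "\<delta>2 > 0" "\<And>c' d. c' \<le> u \<and> u \<le> d \<and> d - c' < \<delta>2 \<Longrightarrow>
          liftable h (({c'..d} \<inter> {0..1}) \<times> {b..c})"
        using trans(2) ac b unfolding P_def by blast
      show "\<exists>\<delta>>0. \<forall>c' d. c' \<le> u \<and> u \<le> d \<and> d - c' < \<delta> \<longrightarrow> liftable h (({c'..d} \<inter> {0..1}) \<times> {a..c})"
      proof (intro exI[of _ "min \<delta>1 \<delta>2"] conjI allI impI)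
        show "0 < min \<delta>1 \<delta>2" using \<delta>1 \<delta>2 by simp
        fix c' d assume cd: "c' \<le> u \<and> u \<le> d \<and> d - c' < min \<delta>1 \<delta>2"
        have int: "(({c'..d} \<inter> {0..1}) \<times> {a..b}) \<inter> (({c'..d} \<inter> {0..1}) \<times> {b..c}) = ({c'..d} \<inter> {0..1}) \<times> {b..b}"
          and un: "({c'..d} \<inter> {0..1}) \<times> {a..c} = (({c'..d} \<inter> {0..1}) \<times> {a..b}) \<union> (({c'..d} \<inter> {0..1}) \<times> {b..c})"
          using trans by auto
        show "liftable h (({c'..d} \<inter> {0..1}) \<times> {a..c})"
          unfolding un
        proof (rule liftable_Un)
          show "connected (({c'..d} \<inter> {0..1}) \<times> {a..b} \<inter> ({c'..d} \<inter> {0..1}) \<times> {b..c})"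
            unfolding int by (intro connected_Times) auto
          show "(u, b) \<in> ({c'..d} \<inter> {0..1}) \<times> {a..b} \<inter> ({c'..d} \<inter> {0..1}) \<times> {b..c}"
            using u cd trans by auto
          show "liftable h (({c'..d} \<inter> {0..1}) \<times> {a..b})" "liftable h (({c'..d} \<inter> {0..1}) \<times> {b..c})"
            using \<delta>1(2) \<delta>2(2) cd by simp_all
        qed (intro closed_Times closed_Int closed_atLeastAtMost)+
      qed
    qed
  next
    fix x :: real assume local: "0 \<le> x" "x \<le> 1"
    then have x: "(u, x) \<in> {0..1} \<times> {0..1}" using u by auto
    then have "h (u, x) \<in> S" using h by blast
    from liftable_local[OF this, where ?'b = "real \<times> real"]
    obtain e where e: "e > 0" "\<And>(k :: real \<times> real \<Rightarrow> 'a) R.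
        continuous_on R k \<Longrightarrow> k ` R \<subseteq> S \<inter> ball (h (u, x)) e \<Longrightarrow> liftable k R"
      by blast
    obtain \<delta> where \<delta>: "\<delta> > 0"
      "\<And>q. q \<in> {0..1} \<times> {0..1} \<Longrightarrow> dist q (u, x) < \<delta> \<Longrightarrow> dist (h q) (h (u, x)) < e"
      using h(1) x e(1) unfolding continuous_on_iff by blast
    have "P a b" if ab: "a \<le> x" "x \<le> b" "b - a < \<delta> / 2" for a b
      unfolding P_def
    proof (intro impI exI[of _ "\<delta> / 2"] conjI allI)
      assume "0 \<le> a \<and> b \<le> 1"
      show "0 < \<delta> / 2" using \<delta> by simp
      fix c d assume cd: "c \<le> u \<and> u \<le> d \<and> d - c < \<delta> / 2"
      have sub: "({c..d} \<inter> {0..1}) \<times> {a..b} \<subseteq> {0..1} \<times> {0..1}"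
        using \<open>0 \<le> a \<and> b \<le> 1\<close> by auto
      have "h q \<in> S \<inter> ball (h (u, x)) e" if q: "q \<in> ({c..d} \<inter> {0..1}) \<times> {a..b}" for q
      proof -
        have "dist q (u, x) \<le> \<bar>fst q - u\<bar> + \<bar>snd q - x\<bar>"
          using sqrt_sum_squares_le_sum_abs[of "fst q - u" "snd q - x"]
          by (simp add: dist_prod_def dist_real_def)
        also have "\<dots> < \<delta>"
          using q cd ab by auto
        finally have "dist (h q) (h (u, x)) < e"
          using \<delta>(2) q sub by blast
        then show ?thesis using q sub h(2) by (auto simp: dist_commute)
      qed
      then show "liftable h (({c..d} \<inter> {0..1}) \<times> {a..b})"
        by (intro e(2) continuous_on_subset[OF h(1) sub]) blast
    qed
    then show "\<exists>d>0. \<forall>a b. a \<le> x \<and> x \<le> b \<and> b - a < d \<longrightarrow> P a b"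
      using \<delta>(1) by (intro exI[of _ "\<delta> / 2"]) auto
  qed
  then show ?thesis unfolding P_def by simp
qed

text \<open>Bisection of the first coordinate, starting from the strips just constructed.  A local system on a
  square is therefore trivial.\<close>

lemma liftable_square:
  fixes h :: "real \<times> real \<Rightarrow> 'a"
  assumes h: "continuous_on ({0..1} \<times> {0..1}) h" "h ` ({0..1} \<times> {0..1}) \<subseteq> S"
  shows "liftable h ({0..1} \<times> {0..1})"
proof -
  define P where "P a b \<longleftrightarrow> 0 \<le> a \<and> b \<le> 1 \<longrightarrow> liftable h ({a..b} \<times> {0..1})" for a b :: real
  have "P 0 1"
  proof (rule Bolzano[of 0 1 P])
    show "(0::real) \<le> 1" by simp
  next
    fix a b c :: real
    assume trans: "P a b" "P b c" "a \<le> b" "b \<le> c"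
    have int: "({a..b} \<times> {0..1}) \<inter> ({b..c} \<times> {0..1}) = {b..b} \<times> {0..1::real}"
      and un: "{a..c} \<times> {0..1} = ({a..b} \<times> {0..1}) \<union> ({b..c} \<times> {0..1::real})"
      using trans by auto
    show "P a c" unfolding P_def un
    proof (intro impI liftable_Un)
      show "connected ({a..b} \<times> {0..1} \<inter> {b..c} \<times> {0..1::real})"
        unfolding int by (intro connected_Times) auto
      show "(b, 0) \<in> {a..b} \<times> {0..1} \<inter> {b..c} \<times> {0..1::real}"
        using trans by auto
      assume "0 \<le> a \<and> c \<le> 1"
      then show "liftable h ({a..b} \<times> {0..1})" "liftable h ({b..c} \<times> {0..1})"
        using trans unfolding P_def by auto
    qed (intro closed_Times closed_atLeastAtMost)+
  next
    fix x :: real assume local: "0 \<le> x" "x \<le> 1"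
    then obtain \<delta> where \<delta>: "\<delta> > 0"
      "\<And>c d. c \<le> x \<and> x \<le> d \<and> d - c < \<delta> \<Longrightarrow> liftable h (({c..d} \<inter> {0..1}) \<times> {0..1})"
      using liftable_strip[OF h, of x] by auto
    have "P c d" if "c \<le> x" "x \<le> d" "d - c < \<delta>" for c d
    proof -
      have "{c..d} \<inter> {0..1} = {c..d}" if "0 \<le> c" "d \<le> 1"
        using that by auto
      then show ?thesis
        using \<delta>(2)[of c d] that unfolding P_def by auto
    qed
    then show "\<exists>d>0. \<forall>a b. a \<le> x \<and> x \<le> b \<and> b - a < d \<longrightarrow> P a b" using \<delta>(1) by blast
  qed
  then show ?thesis by (simp add: P_def)
qed

lemma liftable_path:
  fixes h :: "real \<Rightarrow> 'a"
  assumes h: "continuous_on {0..1} h" "h ` {0..1} \<subseteq> S"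
  shows "liftable h {0..1}"
proof -
  have "liftable (\<lambda>p. h (fst p)) ({0..1::real} \<times> {0..1::real})"
    by (rule liftable_square) (use h in \<open>auto intro!: continuous_on_compose2[OF h(1)] continuous_intros\<close>)
  then obtain G where G: "parallel (\<lambda>p. h (fst p)) ({0..1::real} \<times> {0..1::real}) G"
    "\<forall>p\<in>{0..1} \<times> {0..1}. invertible (G p)"
    unfolding liftable_def by blast
  have "parallel (\<lambda>u. h (fst (u, 0::real))) {0..1} (\<lambda>u. G (u, 0))"
    by (rule parallel_compose[OF G(1)]) (auto intro!: continuous_intros)
  with G(2) show ?thesis
    unfolding liftable_def by auto
qed

end

section \<open>Isomonodromy of integrable connections\<close>

text \<open>An integrable connection, with one flat frame chosen at each point.\<close>

locale flat_connection =
  fixes A \<Omega> :: "complex \<Rightarrow> complex \<Rightarrow> complex^'n^'n" and S :: "(complex \<times> complex) set"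
    and rad :: "complex \<times> complex \<Rightarrow> real"
    and \<Phi> \<Xi> :: "complex \<times> complex \<Rightarrow> complex \<Rightarrow> complex \<Rightarrow> complex^'n^'n"
  assumes rad: "x \<in> S \<Longrightarrow> 0 < rad x"
    and frame: "x \<in> S \<Longrightarrow> flat_frame A \<Omega> (fst x) (snd x) (rad x) (\<Phi> x) (\<Xi> x)"
begin

lemma frameD:
  assumes "x \<in> S" "t \<in> ball (fst x) (rad x)" "z \<in> ball (snd x) (rad x)"
  shows "\<Xi> x t z ** \<Phi> x t z = mat 1" "\<Phi> x t z ** \<Xi> x t z = mat 1"
    and "has_matrix_derivative (\<Phi> x t) (A t z ** \<Phi> x t z) z"
    and "has_matrix_derivative (\<Xi> x t) (- (\<Xi> x t z ** A t z)) z"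
  using frame[OF assms(1)] assms(2,3) matrix_left_right_inverse
  unfolding flat_frame_def by blast+

sublocale local_system S "\<lambda>x y. \<Phi> x (fst y) (snd y)"
proof
  fix x assume x: "x \<in> S"
  show "\<exists>d>0. \<forall>y. dist y x < d \<longrightarrow> invertible (\<Phi> x (fst y) (snd y))"
  proof (intro exI[of _ "rad x"] conjI allI impI rad x)
    fix y assume "dist y x < rad x"
    then have "fst y \<in> ball (fst x) (rad x)" "snd y \<in> ball (snd x) (rad x)"
      using dist_fst_le[of y x] dist_snd_le[of y x] by (auto simp: dist_commute)
    from frameD(1,2)[OF x this] show "invertible (\<Phi> x (fst y) (snd y))"
      unfolding invertible_def by blast
  qed
  show "\<exists>d>0. \<forall>x'\<in>S. dist x' x < d \<longrightarrow> (\<exists>K. \<exists>d'>0. \<forall>y. dist y x' < d' \<longrightarrow>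
      \<Phi> x (fst y) (snd y) = \<Phi> x' (fst y) (snd y) ** K)"
  proof (intro exI[of _ "rad x"] conjI ballI impI rad x)
    fix x' assume x': "x' \<in> S" and near: "dist x' x < rad x"
    define d where "d = min (rad x') (rad x - dist x' x)"
    have "ball p d \<subseteq> ball q (rad x)" if "dist p q \<le> dist x' x" for p q :: complex
    proof
      fix w assume "w \<in> ball p d"
      then show "w \<in> ball q (rad x)"
        using that dist_triangle[of q w p] by (auto simp: d_def dist_commute)
    qed
    then have sub: "ball (fst x') d \<subseteq> ball (fst x') (rad x') \<inter> ball (fst x) (rad x)"
      "ball (snd x') d \<subseteq> ball (snd x') (rad x') \<inter> ball (snd x) (rad x)"
      using dist_fst_le[of x' x] dist_snd_le[of x' x] by (auto simp: d_def)
    have d: "0 < d" using rad[OF x'] near by (simp add: d_def)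
    obtain K where K: "\<forall>t\<in>ball (fst x') d. \<forall>z\<in>ball (snd x') d. \<Phi> x t z = \<Phi> x' t z ** K"
      using flat_frame_compare[OF frame[OF x'] frame[OF x] d sub] by blast
    have "\<Phi> x (fst y) (snd y) = \<Phi> x' (fst y) (snd y) ** K" if "dist y x' < d" for y
    proof -
      have "fst y \<in> ball (fst x') d" "snd y \<in> ball (snd x') d"
        using that dist_fst_le[of y x'] dist_snd_le[of y x'] by (auto simp: dist_commute)
      with K show ?thesis by blast
    qed
    with d show "\<exists>K. \<exists>d'>0. \<forall>y. dist y x' < d' \<longrightarrow>
        \<Phi> x (fst y) (snd y) = \<Phi> x' (fst y) (snd y) ** K"
      by blast
  qed
qed

text \<open>Continuing a solution of the equation in the fibre over \<open>t\<close> is parallel transport in the total space: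
  near a point any solution of the \<open>z\<close> equation is the frame times a constant matrix.\<close>

lemma continued_along_iff_parallel:
  assumes \<gamma>: "continuous_on {0..1} \<gamma>" "\<And>s. s \<in> {0..1} \<Longrightarrow> (t, \<gamma> s) \<in> S"
  shows "continued_along (A t) \<gamma> Y \<longleftrightarrow> parallel (\<lambda>s. (t, \<gamma> s)) {0..1} Y"
proof
  assume Y: "continued_along (A t) \<gamma> Y"
  show "parallel (\<lambda>s. (t, \<gamma> s)) {0..1} Y"
    unfolding parallel_def
  proof (intro conjI ballI)
    show "continuous_on {0..1} (\<lambda>s. (t, \<gamma> s))" using \<gamma>(1) by (intro continuous_intros)
    show "(\<lambda>s. (t, \<gamma> s)) ` {0..1} \<subseteq> S" using \<gamma>(2) by blast
    fix s :: real assume s: "s \<in> {0..1}"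
    let ?x = "(t, \<gamma> s)"
    obtain \<Psi> e d where e: "0 < e" and d: "0 < d" and \<Psi>: "matrix_solution_on (A t) (ball (\<gamma> s) e) \<Psi>"
      and Y\<Psi>: "\<And>r. r \<in> {0..1} \<Longrightarrow> dist r s < d \<Longrightarrow> Y r = \<Psi> (\<gamma> r)"
      using Y s unfolding continued_along_def by blast
    define \<rho> where "\<rho> = min e (rad ?x)"
    have \<rho>: "0 < \<rho>" "\<rho> \<le> e" "\<rho> \<le> rad ?x" using e rad[OF \<gamma>(2)[OF s]] by (auto simp: \<rho>_def)
    have t: "t \<in> ball (fst ?x) (rad ?x)" using rad[OF \<gamma>(2)[OF s]] by simp
    have in_ball: "w \<in> ball (snd ?x) (rad ?x)" if "w \<in> ball (\<gamma> s) \<rho>" for w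
      using that \<rho>(3) by simp
    note D = frameD[OF \<gamma>(2)[OF s] t in_ball]
    have const: "\<Xi> ?x t w ** \<Psi> w = \<Xi> ?x t (\<gamma> s) ** \<Psi> (\<gamma> s)" if w: "w \<in> ball (\<gamma> s) \<rho>" for w
    proof (rule inverse_solution_constant[OF convex_ball open_ball D(4) _ w])
      show "has_matrix_derivative \<Psi> (A t v ** \<Psi> v) v" if "v \<in> ball (\<gamma> s) \<rho>" for v
        using \<Psi> \<rho>(2) that unfolding matrix_solution_on_iff by simp
      show "\<gamma> s \<in> ball (\<gamma> s) \<rho>" using \<rho>(1) by simp
    qed
    obtain d' where d': "d' > 0" "\<And>r. r \<in> {0..1} \<Longrightarrow> dist r s < d' \<Longrightarrow> dist (\<gamma> r) (\<gamma> s) < \<rho>"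
      using \<gamma>(1) s \<rho>(1) unfolding continuous_on_iff by blast
    have "Y r = \<Phi> ?x t (\<gamma> r) ** (\<Xi> ?x t (\<gamma> s) ** \<Psi> (\<gamma> s))" if "r \<in> {0..1}" "dist r s < min d d'" for r
    proof -
      have w: "\<gamma> r \<in> ball (\<gamma> s) \<rho>" using d'(2)[of r] that by (simp add: dist_commute)
      have "Y r = \<Psi> (\<gamma> r)" using Y\<Psi> that by simp
      also have "\<dots> = \<Phi> ?x t (\<gamma> r) ** (\<Xi> ?x t (\<gamma> r) ** \<Psi> (\<gamma> r))"
        by (simp add: matrix_mul_assoc D(2)[OF w])
      finally show ?thesis by (simp add: const[OF w])
    qed
    then show "\<exists>K. \<exists>d>0. \<forall>r\<in>{0..1}. dist r s < d \<longrightarrow>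
        Y r = \<Phi> (t, \<gamma> s) (fst (t, \<gamma> r)) (snd (t, \<gamma> r)) ** K"
      unfolding fst_conv snd_conv using d d'(1)
      by (intro exI[of _ "\<Xi> ?x t (\<gamma> s) ** \<Psi> (\<gamma> s)"] exI[of _ "min d d'"] conjI ballI impI) simp_all
  qed
next
  assume Y: "parallel (\<lambda>s. (t, \<gamma> s)) {0..1} Y"
  show "continued_along (A t) \<gamma> Y"
    unfolding continued_along_def
  proof
    fix s :: real assume s: "s \<in> {0..1}"
    let ?x = "(t, \<gamma> s)"
    obtain K d where d: "d > 0"
      "\<And>r. r \<in> {0..1} \<Longrightarrow> dist r s < d \<Longrightarrow> Y r = \<Phi> ?x t (\<gamma> r) ** K"
      using Y s unfolding parallel_def fst_conv snd_conv by blast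
    have e: "0 < rad ?x" by (rule rad[OF \<gamma>(2)[OF s]])
    obtain d' where d': "d' > 0" "\<And>r. r \<in> {0..1} \<Longrightarrow> dist r s < d' \<Longrightarrow> dist (\<gamma> r) (\<gamma> s) < rad ?x"
      using \<gamma>(1) s e unfolding continuous_on_iff by blast
    have "matrix_solution_on (A t) (ball (\<gamma> s) (rad ?x)) (\<lambda>w. \<Phi> ?x t w ** K)"
      unfolding matrix_solution_on_iff
    proof
      fix w assume w: "w \<in> ball (\<gamma> s) (rad ?x)"
      have "has_matrix_derivative (\<Phi> ?x t) (A t w ** \<Phi> ?x t w) w"
        by (rule frameD(3)[OF \<gamma>(2)[OF s]]) (use e w in simp_all)
      from has_matrix_derivative_mult[OF this has_matrix_derivative_const[of K]]
      show "has_matrix_derivative (\<lambda>w. \<Phi> ?x t w ** K) (A t w ** (\<Phi> ?x t w ** K)) w"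
        by (simp add: matrix_mul_assoc)
    qed
    moreover have "\<gamma> r \<in> ball (\<gamma> s) (rad ?x) \<and> Y r = \<Phi> ?x t (\<gamma> r) ** K"
      if "r \<in> {0..1}" "dist r s < min d d'" for r
      using d(2)[of r] d'(2)[of r] that by (simp add: dist_commute)
    ultimately show "\<exists>\<Psi> e d. 0 < e \<and> 0 < d \<and> matrix_solution_on (A t) (ball (\<gamma> s) e) \<Psi> \<and>
        (\<forall>r\<in>{0..1}. dist r s < d \<longrightarrow> \<gamma> r \<in> ball (\<gamma> s) e \<and> Y r = \<Psi> (\<gamma> r))"
      using e d(1) d'(1)
      by (intro exI[of _ "\<lambda>w. \<Phi> ?x t w ** K"] exI[of _ "rad ?x"] exI[of _ "min d d'"] conjI ballI impI)
        simp_all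
  qed
qed

lemma monodromy_eq:
  assumes Y: "parallel (\<lambda>s. (t, \<gamma> s)) {0..1} Y" and Y0: "Y 0 = mat 1"
  shows "monodromy (A t) \<gamma> = Y 1"
proof -
  have "continuous_on {0..1} (\<lambda>s. snd (t, \<gamma> s))"
    using Y unfolding parallel_def by (intro continuous_on_snd) blast
  then have \<gamma>: "continuous_on {0..1} \<gamma>" "\<And>s. s \<in> {0..1} \<Longrightarrow> (t, \<gamma> s) \<in> S"
    using Y unfolding parallel_def by auto
  show ?thesis
    unfolding monodromy_def
  proof (rule the_equality)
    show "\<exists>Y'. continued_along (A t) \<gamma> Y' \<and> Y' 0 = mat 1 \<and> Y' 1 = Y 1"
      using Y Y0 continued_along_iff_parallel[OF \<gamma>] by blast
    fix M assume "\<exists>Y'. continued_along (A t) \<gamma> Y' \<and> Y' 0 = mat 1 \<and> Y' 1 = M"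
    then obtain Y' where Y': "parallel (\<lambda>s. (t, \<gamma> s)) {0..1} Y'" "Y' 0 = mat 1" "Y' 1 = M"
      using continued_along_iff_parallel[OF \<gamma>] by blast
    have "Y' 1 = Y 1"
      by (rule parallel_unique[OF Y'(1) Y, of 0]) (use Y0 Y'(2) in auto)
    with Y'(3) show "M = Y 1" by simp
  qed
qed

text \<open>A homotopy \<open>H\<close> between corresponding loops is a square whose rows are loops, so that its two sides
  \<open>u \<mapsto> H (u, 0)\<close> and \<open>u \<mapsto> H (u, 1)\<close> are one and the same path.  A parallel section \<open>G\<close> over the square with
  \<open>G (0, 0) = mat 1\<close> therefore satisfies \<open>G (1, 1) = G (1, 0) ** G (0, 1)\<close>.  Here \<open>G (0, 1)\<close> is the first
  monodromy, and normalising the row \<open>u = 1\<close> at its start shows that the second monodromy is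
  \<open>G (1, 1)\<close> times the inverse of \<open>G (1, 0)\<close>.

  The conjugating matrix \<open>G (1, 0)\<close> is the transport along the path of base points.  That path runs in the
  image of the section over a disk, where it can be contracted to the path over the straight segment from \<open>t1\<close>
  to \<open>t2\<close> with fixed ends.  So \<open>G (1, 0)\<close> does not depend on the loops.\<close>

lemma isomonodromic:
  assumes S: "\<And>t z. t \<in> U \<Longrightarrow> z \<notin> {0, t, 1} \<Longrightarrow> (t, z) \<in> S"
  shows "isomonodromic_on U A"
  unfolding isomonodromic_on_def Let_def
proof (intro allI impI ballI)
  fix t0 r b t1 t2
  assume D: "ball t0 r \<subseteq> U - {0, 1} \<and> continuous_on (ball t0 r) b \<and> (\<forall>t\<in>ball t0 r. b t \<notin> {0, t, 1})"
    and t1: "t1 \<in> ball t0 r" and t2: "t2 \<in> ball t0 r"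
  define D where "D = ball t0 r"
  define \<sigma> where "\<sigma> t = (t, b t)" for t
  have \<sigma>: "continuous_on D \<sigma>" "\<And>t. t \<in> D \<Longrightarrow> \<sigma> t \<in> S"
  proof -
    show "continuous_on D \<sigma>"
      using D unfolding D_def \<sigma>_def by (intro continuous_on_Pair continuous_on_id) blast
    show "\<sigma> t \<in> S" if "t \<in> D" for t
      using D S that unfolding D_def \<sigma>_def by blast
  qed
  have sub: "punctured_spheres D \<subseteq> S"
    using D S unfolding D_def punctured_spheres_def by blast
  have convD: "(1 - u) *\<^sub>R p + u *\<^sub>R q \<in> D" if "p \<in> D" "q \<in> D" "u \<in> {0..1}" for p q and u :: real
    using that convexD[of D p q "1 - u" u] by (simp add: D_def)
  have t12: "t1 \<in> D" "t2 \<in> D" using t1 t2 by (simp_all add: D_def)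
  define lin where "lin u = (1 - u) *\<^sub>R t1 + u *\<^sub>R t2" for u :: real
  have lin: "continuous_on {0..1} lin" "\<And>u. u \<in> {0..1} \<Longrightarrow> lin u \<in> D" "lin 0 = t1" "lin 1 = t2"
    unfolding lin_def by (auto intro!: continuous_intros convD t12)
  have "liftable (\<lambda>u. \<sigma> (lin u)) {0..1}"
    using continuous_on_compose2[OF \<sigma>(1) lin(1)] \<sigma>(2) lin(2) by (intro liftable_path) blast+
  moreover have "(0::real) \<in> {0..1}" by simp
  ultimately have "\<exists>G. parallel (\<lambda>u. \<sigma> (lin u)) {0..1} G \<and> (\<forall>u\<in>{0..1}. invertible (G u)) \<and> G 0 = mat 1"
    by (rule liftable_normalized)
  then obtain G0 where G0: "parallel (\<lambda>u. \<sigma> (lin u)) {0..1} G0" "\<forall>u\<in>{0..1}. invertible (G0 u)" "G0 0 = mat 1"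
    by blast
  have origin: "(0, 0) \<in> {0..1::real} \<times> {0..1::real}" by simp
  show "\<exists>C. invertible C \<and> (\<forall>\<gamma>1 \<gamma>2. corresponding_loops (ball t0 r) b t1 \<gamma>1 t2 \<gamma>2 \<longrightarrow>
      monodromy (A t2) \<gamma>2 = C ** monodromy (A t1) \<gamma>1 ** matrix_inv C)"
  proof (intro exI[of _ "G0 1"] conjI allI impI)
    show inv: "invertible (G0 1)" using G0(2) by simp
    fix \<gamma>1 \<gamma>2 assume "corresponding_loops (ball t0 r) b t1 \<gamma>1 t2 \<gamma>2"
    then obtain H where Hc: "continuous_map (prod_topology (top_of_set {0..1}) (top_of_set {0..1}))
        (top_of_set (punctured_spheres D)) H"
      and H0: "\<And>s. H (0, s) = (t1, \<gamma>1 s)" and H1: "\<And>s. H (1, s) = (t2, \<gamma>2 s)"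
      and loop: "\<And>u. u \<in> {0..1::real} \<Longrightarrow> H (u, 1) = H (u, 0) \<and> H (u, 0) \<in> \<sigma> ` D"
      unfolding corresponding_loops_def homotopic_with_def D_def[symmetric]
        pathfinish_def pathstart_def \<sigma>_def by blast
    have H: "continuous_on ({0..1} \<times> {0..1}) H" "H ` ({0..1} \<times> {0..1}) \<subseteq> S"
      using Hc sub by (simp_all add: prod_topology_subtopology_eu continuous_map_subtopology_eu image_subset_iff_funcset)
        blast
    obtain G where G: "parallel H ({0..1} \<times> {0..1}) G" "\<forall>p\<in>{0..1} \<times> {0..1}. invertible (G p)"
      "G (0, 0) = mat 1"
      using liftable_normalized[OF liftable_square[OF H] origin] by blast
    have edge: "parallel (\<lambda>u. H (k u)) {0..1} (\<lambda>u. G (k u))"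
      if "continuous_on {0..1} k" "k ` {0..1} \<subseteq> {0..1} \<times> {0..1}" for k :: "real \<Rightarrow> real \<times> real"
      by (rule parallel_compose[OF G(1) that])
    have M1: "monodromy (A t1) \<gamma>1 = G (0, 1)"
    proof (rule monodromy_eq)
      have "parallel (\<lambda>s. H (0, s)) {0..1} (\<lambda>s. G (0, s))"
        by (rule edge) (auto intro!: continuous_intros)
      then show "parallel (\<lambda>s. (t1, \<gamma>1 s)) {0..1} (\<lambda>s. G (0, s))"
        by (simp only: H0)
    qed (rule G(3))
    have bottom: "parallel (\<lambda>u. H (u, 0)) {0..1} (\<lambda>u. G (u, 0))"
      by (rule edge) (auto intro!: continuous_intros)
    have top: "parallel (\<lambda>u. H (u, 1)) {0..1} (\<lambda>u. G (u, 1))"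
      by (rule edge) (auto intro!: continuous_intros)
    have "parallel (\<lambda>u. H (u, 0)) {0..1} (\<lambda>u. G (u, 1))"
      by (rule parallel_cong[OF top]) (use loop in blast)
    from parallel_unique[OF this parallel_mult[OF bottom, of "G (0, 1)"], of 0 1] G(3)
    have G11: "G (1, 1) = G (1, 0) ** G (0, 1)"
      by simp
    define \<tau> where "\<tau> u = fst (H (u, 0))" for u
    have \<tau>: "continuous_on {0..1} \<tau>" "\<And>u. u \<in> {0..1} \<Longrightarrow> \<tau> u \<in> D"
      "\<And>u. u \<in> {0..1} \<Longrightarrow> H (u, 0) = \<sigma> (\<tau> u)" "\<tau> 0 = t1" "\<tau> 1 = t2"
    proof -
      show "continuous_on {0..1} \<tau>"
        using bottom unfolding parallel_def \<tau>_def by (intro continuous_on_fst) blast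
      show "\<tau> u \<in> D" "H (u, 0) = \<sigma> (\<tau> u)" if "u \<in> {0..1}" for u
        using loop[OF that] by (auto simp: \<tau>_def \<sigma>_def)
      show "\<tau> 0 = t1" "\<tau> 1 = t2" by (simp_all add: \<tau>_def H0 H1)
    qed
    have G10: "G (1, 0) = G0 1"
    proof -
      \<comment> \<open>the contraction: row \<open>s\<close> interpolates between the two paths in the disk\<close>
      define k where "k p = \<sigma> ((1 - snd p) *\<^sub>R \<tau> (fst p) + snd p *\<^sub>R lin (fst p))" for p :: "real \<times> real"
      have "continuous_on ({0..1} \<times> {0..1}) k"
        unfolding k_def
        by (rule continuous_on_compose2[OF \<sigma>(1)])
          (auto intro!: continuous_intros continuous_on_compose2[OF \<tau>(1)] continuous_on_compose2[OF lin(1)]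
            convD \<tau> lin)
      moreover have "k ` ({0..1} \<times> {0..1}) \<subseteq> S"
        unfolding k_def using \<tau>(2) lin(2) by (auto intro!: \<sigma>(2) convD)
      ultimately have "liftable k ({0..1} \<times> {0..1})"
        by (rule liftable_square)
      from liftable_normalized[OF this origin]
      obtain J where J: "parallel k ({0..1} \<times> {0..1}) J" "J (0, 0) = mat 1"
        by blast
      have edge: "parallel (\<lambda>u. k (g u)) {0..1} (\<lambda>u. J (g u))"
        if "continuous_on {0..1} g" "g ` {0..1} \<subseteq> {0..1} \<times> {0..1}" for g :: "real \<Rightarrow> real \<times> real"
        by (rule parallel_compose[OF J(1) that])
      \<comment> \<open>at the ends \<open>c = 0\<close> and \<open>c = 1\<close> the contraction stays at one point, and so does the section\<close>
      have side: "J (c, 1) = J (c, 0)" if c: "c \<in> {0..1}" and "\<tau> c = lin c" for c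
      proof (rule parallel_unique[of "\<lambda>s. k (c, s)" "{0..1}" "\<lambda>s. J (c, s)" "\<lambda>s. J (c, 0)" 0])
        show "parallel (\<lambda>s. k (c, s)) {0..1} (\<lambda>s. J (c, s))"
          by (rule edge) (use c in \<open>auto intro!: continuous_intros\<close>)
        have "k (c, s) = \<sigma> (lin c)" for s
          using that(2) by (simp add: k_def algebra_simps flip: scaleR_add_left)
        then show "parallel (\<lambda>s. k (c, s)) {0..1} (\<lambda>s. J (c, 0))"
          using parallel_const[OF \<sigma>(2)[OF lin(2)[OF c]]] by simp
      qed auto
      have "parallel (\<lambda>u. k (u, 1)) {0..1} (\<lambda>u. J (u, 1))"
        by (rule edge) (auto intro!: continuous_intros)
      then have "parallel (\<lambda>u. \<sigma> (lin u)) {0..1} (\<lambda>u. J (u, 1))"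
        by (simp add: k_def)
      moreover have "J (0, 1) = mat 1" using side[of 0] J(2) by (simp add: \<tau> lin)
      ultimately have "J (1, 1) = G0 1"
        using parallel_unique[OF _ G0(1), of "\<lambda>u. J (u, 1)" 0 1] G0(3) by simp
      moreover have "parallel (\<lambda>u. k (u, 0)) {0..1} (\<lambda>u. J (u, 0))"
        by (rule edge) (auto intro!: continuous_intros)
      then have "parallel (\<lambda>u. H (u, 0)) {0..1} (\<lambda>u. J (u, 0))"
        by (rule parallel_cong) (simp add: k_def \<tau>(3))
      then have "J (1, 0) = G (1, 0)"
        using parallel_unique[OF _ bottom, of "\<lambda>u. J (u, 0)" 0 1] G(3) J(2) by simp
      ultimately show ?thesis using side[of 1] by (simp add: \<tau> lin)
    qed
    have inv': "G (1, 0) ** matrix_inv (G0 1) = mat 1"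
      using inv unfolding G10 invertible_def matrix_inv_def by (rule someI2_ex) blast
    have "parallel (\<lambda>s. H (1, s)) {0..1} (\<lambda>s. G (1, s))"
      by (rule edge) (auto intro!: continuous_intros)
    then have "parallel (\<lambda>s. (t2, \<gamma>2 s)) {0..1} (\<lambda>s. G (1, s) ** matrix_inv (G0 1))"
      using parallel_mult by (simp add: H1)
    from monodromy_eq[OF this inv']
    show "monodromy (A t2) \<gamma>2 = G0 1 ** monodromy (A t1) \<gamma>1 ** matrix_inv (G0 1)"
      by (simp add: G11 M1 G10)
  qed
qed

end

section \<open>Schlesinger deformations of Fuchsian systems\<close>

lemma geometric_inverse_sums:
  fixes c w :: complex
  assumes "norm w < norm c"
  shows "(\<lambda>j. (-1) ^ j / c ^ Suc j * w ^ j) sums (1 / (c + w))"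
proof -
  have c: "c \<noteq> 0" "norm (- w / c) < 1"
    using assms by (auto simp: norm_divide intro!: divide_less_eq_1_pos[THEN iffD2] intro: le_less_trans[OF norm_ge_zero])
  have "c + w \<noteq> 0"
    using assms by (metis add_eq_0_iff norm_minus_cancel order_less_irrefl)
  then have "1 / c * (1 / (1 - - w / c)) = 1 / (c + w)"
    using c(1) by (simp add: field_simps)
  moreover have "1 / c * (- w / c) ^ j = (-1) ^ j / c ^ Suc j * w ^ j" for j
    using c(1) power_minus[of "w / c" j] by (simp add: power_divide)
  ultimately show ?thesis
    using sums_mult[OF geometric_sums[OF c(2)], of "1 / c"] by simp
qed

lemma matrix_entries_bounded:
  fixes B :: "complex \<Rightarrow> complex^'n^'m"
  assumes "compact K" "\<And>i j. continuous_on K (\<lambda>t. B t $ i $ j)"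
  shows "\<exists>M\<ge>0. \<forall>t\<in>K. \<forall>i j. norm (B t $ i $ j) \<le> M"
proof -
  have "continuous_on K (\<lambda>t. \<chi> i. \<chi> j. B t $ i $ j)"
    by (intro continuous_on_vec_lambda assms(2))
  then have "bounded (B ` K)"
    using compact_continuous_image[OF _ assms(1)] compact_imp_bounded by (force simp: vec_lambda_eta)
  then obtain M where M: "\<forall>t\<in>K. norm (B t) \<le> M"
    unfolding bounded_iff by blast
  have "norm (B t $ i $ j) \<le> \<bar>M\<bar>" if "t \<in> K" for t i j
  proof -
    have "norm (B t $ i $ j) \<le> norm (B t $ i)" "norm (B t $ i) \<le> norm (B t)" "norm (B t) \<le> M"
      using M that Finite_Cartesian_Product.norm_nth_le by blast+
    then show ?thesis by linarith
  qed
  then show ?thesis by (intro exI[of _ "\<bar>M\<bar>"]) auto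
qed

text \<open>The \<open>dt\<close> part of the connection.  The pole at \<open>z = t\<close> moves with \<open>t\<close>, which forces the term in \<open>B2\<close>; the
  matrix \<open>P\<close> is a change of gauge depending on \<open>t\<close> only.\<close>

definition deformation_matrix ::
  "complex^'n^'n \<Rightarrow> complex^'n^'n \<Rightarrow> complex \<Rightarrow> complex \<Rightarrow> complex^'n^'n"
where
  "deformation_matrix P B2 t z = (\<chi> i j. P $ i $ j - B2 $ i $ j / (z - t))"

lemma fuchsian_matrix_power_series:
  fixes B1 B2 B3 :: "complex^'n^'n"
  assumes "norm (z - z0) < norm z0" "norm (z - z0) < norm (z0 - t)" "norm (z - z0) < norm (z0 - 1)"
  shows "fuchsian_matrix B1 B2 B3 t z = power_series_matrix
    (\<lambda>k. \<chi> i j. B1 $ i $ j * ((-1) ^ k / z0 ^ Suc k) + B2 $ i $ j * ((-1) ^ k / (z0 - t) ^ Suc k) +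
      B3 $ i $ j * ((-1) ^ k / (z0 - 1) ^ Suc k)) (z - z0)"
proof -
  note S = assms[THEN geometric_inverse_sums, THEN sums_mult]
  have "fuchsian_matrix B1 B2 B3 t z $ i $ j = (\<Sum>k. (B1 $ i $ j * ((-1) ^ k / z0 ^ Suc k) +
      B2 $ i $ j * ((-1) ^ k / (z0 - t) ^ Suc k) +
      B3 $ i $ j * ((-1) ^ k / (z0 - 1) ^ Suc k)) * (z - z0) ^ k)" for i j
    using sums_unique[OF sums_add[OF sums_add[OF S(1)[of "B1 $ i $ j"] S(2)[of "B2 $ i $ j"]] S(3)[of "B3 $ i $ j"]]]
    by (simp add: fuchsian_matrix_def distrib_right mult.assoc)
  then show ?thesis
    by (simp add: vec_eq_iff power_series_matrix_def)
qed

text \<open>The curvature is a rational function of \<open>z\<close>.  Its double pole at \<open>z = t\<close> cancels, it vanishes at infinity,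
  and its residues at \<open>0\<close>, \<open>t\<close> and \<open>1\<close> vanish by \<open>eq1\<close>, \<open>eq2\<close> and \<open>eq3\<close>.\<close>

lemma schlesinger_zero_curvature:
  fixes B1 B2 B3 :: "complex \<Rightarrow> complex^'n^'n" and B1' B2' B3' P :: "complex^'n^'n"
  assumes B: "has_matrix_derivative B1 B1' t" "has_matrix_derivative B2 B2' t"
      "has_matrix_derivative B3 B3' t"
    and t: "t \<noteq> 0" "t \<noteq> 1" and z: "z \<notin> {0, t, 1}"
    and eq1: "\<And>i j. B1' $ i $ j = (P ** B1 t - B1 t ** P) $ i $ j + (B2 t ** B1 t - B1 t ** B2 t) $ i $ j / t"
    and eq2: "\<And>i j. B2' $ i $ j = (P ** B2 t - B2 t ** P) $ i $ j - (B2 t ** B1 t - B1 t ** B2 t) $ i $ j / t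
       - (B2 t ** B3 t - B3 t ** B2 t) $ i $ j / (t - 1)"
    and eq3: "\<And>i j. B3' $ i $ j = (P ** B3 t - B3 t ** P) $ i $ j + (B2 t ** B3 t - B3 t ** B2 t) $ i $ j / (t - 1)"
  defines "A \<equiv> \<lambda>t. fuchsian_matrix (B1 t) (B2 t) (B3 t) t"
    and "\<Omega> \<equiv> deformation_matrix P (B2 t) t"
  shows "\<exists>At \<Omega>z. has_matrix_derivative (\<lambda>t. A t z) At t \<and> has_matrix_derivative \<Omega> \<Omega>z z \<and>
    At + A t z ** \<Omega> z = \<Omega>z + \<Omega> z ** A t z"
proof -
  define At where "At = (\<chi> i j. B1' $ i $ j / z + B2' $ i $ j / (z - t) + B2 t $ i $ j / (z - t)\<^sup>2
    + B3' $ i $ j / (z - 1))"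
  define \<Omega>z where "\<Omega>z = (\<chi> i j. B2 t $ i $ j / (z - t)\<^sup>2)"
  have nz: "z \<noteq> 0" "z - t \<noteq> 0" "z - 1 \<noteq> 0" "t - 1 \<noteq> 0" using z t by auto
  have "((\<lambda>t. B2 t $ i $ j / (z - t)) has_field_derivative
      (B2' $ i $ j / (z - t) + B2 t $ i $ j / (z - t)\<^sup>2)) (at t)" for i j
    using has_matrix_derivativeD[OF B(2)] nz
    by (auto intro!: derivative_eq_intros simp: divide_simps power2_eq_square)
  from DERIV_add[OF DERIV_add[OF DERIV_cdivide[OF has_matrix_derivativeD[OF B(1)]] this]
      DERIV_cdivide[OF has_matrix_derivativeD[OF B(3)]]]
  have "has_matrix_derivative (\<lambda>t. A t z) At t"
    unfolding has_matrix_derivative_def A_def fuchsian_matrix_def At_def by (simp add: add.assoc)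
  moreover have "has_matrix_derivative \<Omega> \<Omega>z z"
    using nz unfolding has_matrix_derivative_def \<Omega>_def deformation_matrix_def \<Omega>z_def
    by (auto intro!: derivative_eq_intros simp: field_simps power2_eq_square)
  moreover have "At + A t z ** \<Omega> z = \<Omega>z + \<Omega> z ** A t z"
  proof -
    have AO: "(A t z ** \<Omega> z) $ i $ j = (B1 t ** P) $ i $ j / z + (B2 t ** P) $ i $ j / (z - t) + (B3 t ** P) $ i $ j / (z - 1)
      - (B1 t ** B2 t) $ i $ j / (z * (z - t)) - (B2 t ** B2 t) $ i $ j / (z - t)\<^sup>2
      - (B3 t ** B2 t) $ i $ j / ((z - 1) * (z - t))" for i j
      unfolding matrix_matrix_mult_def A_def \<Omega>_def fuchsian_matrix_def deformation_matrix_def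
      by (simp add: sum_divide_distrib sum.distrib[symmetric] sum_subtractf[symmetric])
        (simp add: distrib_right right_diff_distrib power2_eq_square algebra_simps)
    have OA: "(\<Omega> z ** A t z) $ i $ j = (P ** B1 t) $ i $ j / z + (P ** B2 t) $ i $ j / (z - t) + (P ** B3 t) $ i $ j / (z - 1)
      - (B2 t ** B1 t) $ i $ j / (z * (z - t)) - (B2 t ** B2 t) $ i $ j / (z - t)\<^sup>2
      - (B2 t ** B3 t) $ i $ j / ((z - 1) * (z - t))" for i j
      unfolding matrix_matrix_mult_def A_def \<Omega>_def fuchsian_matrix_def deformation_matrix_def
      by (simp add: sum_divide_distrib sum.distrib[symmetric] sum_subtractf[symmetric])
        (simp add: distrib_left left_diff_distrib power2_eq_square algebra_simps)
    have pf: "u / (z * (z - t)) = u / t / (z - t) - u / t / z"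
      "u / ((z - 1) * (z - t)) = u / (t - 1) / (z - t) - u / (t - 1) / (z - 1)" for u
      using nz t(1) by (simp_all add: divide_simps) (simp_all add: algebra_simps)
    have "At $ i $ j + (A t z ** \<Omega> z) $ i $ j = \<Omega>z $ i $ j + (\<Omega> z ** A t z) $ i $ j" for i j
      unfolding AO OA pf At_def \<Omega>z_def
      by (simp add: eq1 eq2 eq3 add_divide_distrib diff_divide_distrib)
    then show ?thesis by (simp add: vec_eq_iff)
  qed
  ultimately show ?thesis by blast
qed

lemma schlesinger_flat_frame:
  fixes B1 B2 B3 B1' B2' B3' P :: "complex \<Rightarrow> complex^'n^'n"
  assumes U: "open U" "0 \<notin> U" "1 \<notin> U"
    and B: "\<And>t. t \<in> U \<Longrightarrow> has_matrix_derivative B1 (B1' t) t" "\<And>t. t \<in> U \<Longrightarrow> has_matrix_derivative B2 (B2' t) t"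
      "\<And>t. t \<in> U \<Longrightarrow> has_matrix_derivative B3 (B3' t) t"
    and P: "\<And>i j. (\<lambda>t. P t $ i $ j) holomorphic_on U"
    and eq1: "\<And>t i j. t \<in> U \<Longrightarrow> B1' t $ i $ j =
      (P t ** B1 t - B1 t ** P t) $ i $ j + (B2 t ** B1 t - B1 t ** B2 t) $ i $ j / t"
    and eq2: "\<And>t i j. t \<in> U \<Longrightarrow> B2' t $ i $ j =
      (P t ** B2 t - B2 t ** P t) $ i $ j - (B2 t ** B1 t - B1 t ** B2 t) $ i $ j / t
       - (B2 t ** B3 t - B3 t ** B2 t) $ i $ j / (t - 1)"
    and eq3: "\<And>t i j. t \<in> U \<Longrightarrow> B3' t $ i $ j =
      (P t ** B3 t - B3 t ** P t) $ i $ j + (B2 t ** B3 t - B3 t ** B2 t) $ i $ j / (t - 1)"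
    and t0: "t0 \<in> U" and z0: "z0 \<notin> {0, t0, 1}"
  shows "\<exists>e>0. \<exists>\<Phi> \<Xi>. flat_frame (\<lambda>t. fuchsian_matrix (B1 t) (B2 t) (B3 t) t)
    (\<lambda>t. deformation_matrix (P t) (B2 t) t) t0 z0 e \<Phi> \<Xi>"
proof -
  have B_hol: "(\<lambda>t. B1 t $ i $ j) holomorphic_on U" "(\<lambda>t. B2 t $ i $ j) holomorphic_on U"
    "(\<lambda>t. B3 t $ i $ j) holomorphic_on U" for i j
    using B unfolding holomorphic_on_open[OF U(1)] has_matrix_derivative_def by blast+
  \<comment> \<open>for \<open>t\<close> within \<open>\<delta>\<close> of \<open>t0\<close> the three poles keep the distance \<open>\<delta>\<close> from \<open>z0\<close>\<close>
  define \<delta> where "\<delta> = min (norm z0) (min (norm (z0 - t0) / 2) (norm (z0 - 1)))"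
  have \<delta>: "0 < \<delta>" "\<delta> \<le> norm z0" "\<delta> \<le> norm (z0 - t0) / 2" "\<delta> \<le> norm (z0 - 1)"
    using z0 by (auto simp: \<delta>_def)
  obtain \<epsilon> where \<epsilon>: "0 < \<epsilon>" "cball t0 \<epsilon> \<subseteq> U"
    using U(1) t0 open_contains_cball by blast
  define r where "r = min (\<delta> / 2) \<epsilon>"
  have r: "0 < r" "r < \<delta>" "cball t0 r \<subseteq> U"
    using \<delta>(1) \<epsilon> by (auto simp: r_def)
  then have ball_U: "t \<in> U" if "t \<in> ball t0 r" for t
    using that ball_subset_cball by blast
  have far: "\<delta> \<le> norm (z0 - t)" if "t \<in> ball t0 r" for t
  proof -
    have "norm (z0 - t0) \<le> norm (z0 - t) + norm (t - t0)"
      using norm_triangle_ineq[of "z0 - t" "t - t0"] by simp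
    moreover have "norm (t - t0) < \<delta>"
      using that r(2) by (simp add: dist_norm norm_minus_commute)
    ultimately show ?thesis using \<delta>(3) by simp
  qed
  have cont: "continuous_on (cball t0 r) (\<lambda>t. B1 t $ i $ j)" "continuous_on (cball t0 r) (\<lambda>t. B2 t $ i $ j)"
    "continuous_on (cball t0 r) (\<lambda>t. B3 t $ i $ j)" for i j
    using B_hol holomorphic_on_imp_continuous_on continuous_on_subset r(3) by blast+
  obtain M1 where M1: "0 \<le> M1" "\<And>t i j. t \<in> cball t0 r \<Longrightarrow> norm (B1 t $ i $ j) \<le> M1"
    using matrix_entries_bounded[OF compact_cball cont(1)] by blast
  obtain M2 where M2: "0 \<le> M2" "\<And>t i j. t \<in> cball t0 r \<Longrightarrow> norm (B2 t $ i $ j) \<le> M2"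
    using matrix_entries_bounded[OF compact_cball cont(2)] by blast
  obtain M3 where M3: "0 \<le> M3" "\<And>t i j. t \<in> cball t0 r \<Longrightarrow> norm (B3 t $ i $ j) \<le> M3"
    using matrix_entries_bounded[OF compact_cball cont(3)] by blast
  define a where "a k t = (\<chi> i j. B1 t $ i $ j * ((-1) ^ k / z0 ^ Suc k) +
      B2 t $ i $ j * ((-1) ^ k / (z0 - t) ^ Suc k) + B3 t $ i $ j * ((-1) ^ k / (z0 - 1) ^ Suc k))" for k t
  have geo: "norm (u * ((-1) ^ k / c ^ Suc k)) \<le> N / \<delta> * (1 / \<delta>) ^ k"
    if "norm u \<le> N" "\<delta> \<le> norm c" for u c :: complex and N k
  proof -
    have "norm (u * ((-1) ^ k / c ^ Suc k)) = norm u * (1 / norm c ^ Suc k)"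
      by (simp add: norm_mult norm_divide norm_power)
    also have "\<dots> \<le> N * (1 / \<delta> ^ Suc k)"
    proof (intro mult_mono divide_left_mono power_mono mult_pos_pos zero_less_power)
      show "0 < norm c" using that \<delta>(1) by linarith
      show "0 \<le> N" using that(1) norm_ge_zero order_trans by blast
    qed (use that \<delta>(1) in auto)
    finally show ?thesis by (simp add: power_divide)
  qed
  show ?thesis
  proof (rule flat_frame_exists[OF r(1), where a = a and M = "(M1 + M2 + M3) / \<delta>" and \<rho> = "1 / \<delta>"])
    show "(\<lambda>t. a k t $ i $ j) holomorphic_on ball t0 r" for k i j
    proof -
      have "z0 - t \<noteq> 0" if "t \<in> ball t0 r" for t
        using far[OF that] \<delta>(1) by auto
      moreover have "(\<lambda>t. B1 t $ i $ j) holomorphic_on ball t0 r" "(\<lambda>t. B2 t $ i $ j) holomorphic_on ball t0 r"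
        "(\<lambda>t. B3 t $ i $ j) holomorphic_on ball t0 r"
        using B_hol holomorphic_on_subset ball_U by blast+
      ultimately show ?thesis
        unfolding a_def vec_lambda_beta by (intro holomorphic_intros) auto
    qed
    show "norm (a k t $ i $ j) \<le> (M1 + M2 + M3) / \<delta> * (1 / \<delta>) ^ k" if t: "t \<in> ball t0 r" for k i j t
    proof -
      have "t \<in> cball t0 r" using t by simp
      note N = M1(2)[OF this] M2(2)[OF this] M3(2)[OF this]
      have "norm (a k t $ i $ j) \<le> M1 / \<delta> * (1 / \<delta>) ^ k + M2 / \<delta> * (1 / \<delta>) ^ k + M3 / \<delta> * (1 / \<delta>) ^ k"
        unfolding a_def vec_lambda_beta
        by (intro norm_triangle_mono geo N \<delta>(2,4) far[OF t])
      then show ?thesis by (simp add: add_divide_distrib distrib_right)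
    qed
    show "0 \<le> (M1 + M2 + M3) / \<delta>" "0 < 1 / \<delta>"
      using M1(1) M2(1) M3(1) \<delta>(1) by simp_all
    show "fuchsian_matrix (B1 t) (B2 t) (B3 t) t z = power_series_matrix (\<lambda>k. a k t) (z - z0)"
      if t: "t \<in> ball t0 r" and z: "z \<in> ball z0 r" for t z
    proof -
      have "norm (z - z0) < \<delta>"
        using z r(2) by (simp add: dist_norm norm_minus_commute)
      then show ?thesis
        unfolding a_def using \<delta>(2,4) far[OF t]
        by (intro fuchsian_matrix_power_series) linarith+
    qed
    show "(\<lambda>t. deformation_matrix (P t) (B2 t) t z0 $ i $ j) holomorphic_on ball t0 r" for i j
    proof -
      have "z0 - t \<noteq> 0" if "t \<in> ball t0 r" for t
        using far[OF that] \<delta>(1) by auto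
      moreover have "(\<lambda>t. P t $ i $ j) holomorphic_on ball t0 r" "(\<lambda>t. B2 t $ i $ j) holomorphic_on ball t0 r"
        using P B_hol holomorphic_on_subset ball_U by blast+
      ultimately show ?thesis
        unfolding deformation_matrix_def vec_lambda_beta by (intro holomorphic_intros) auto
    qed
    show "\<exists>At \<Omega>z. has_matrix_derivative (\<lambda>t. fuchsian_matrix (B1 t) (B2 t) (B3 t) t z) At t \<and>
        has_matrix_derivative (deformation_matrix (P t) (B2 t) t) \<Omega>z z \<and>
        At + fuchsian_matrix (B1 t) (B2 t) (B3 t) t z ** deformation_matrix (P t) (B2 t) t z =
        \<Omega>z + deformation_matrix (P t) (B2 t) t z ** fuchsian_matrix (B1 t) (B2 t) (B3 t) t z"
      if t: "t \<in> ball t0 r" and z: "z \<in> ball z0 r" for t z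
    proof -
      note tU = ball_U[OF t]
      have zr: "norm (z0 - z) < \<delta>"
        using z r(2) by (simp add: dist_norm)
      have "t \<noteq> 0" "t \<noteq> 1" using tU U by auto
      moreover have "z \<notin> {0, t, 1}"
        using zr \<delta>(2,4) far[OF t] by auto
      ultimately show ?thesis
        by (intro schlesinger_zero_curvature[OF B(1-3)[OF tU] _ _ _ eq1[OF tU] eq2[OF tU] eq3[OF tU]])
    qed
  qed
qed

section \<open>The Hamiltonian form of Painleve VI\<close>

text \<open>The coefficient of \<open>y'\<close> in the definition of \<open>x\<close> is \<open>t (t - 1) / (y (y - 1) (y - t))\<close>.  Solving for \<open>y'\<close> gives a
  polynomial in \<open>x\<close> and \<open>y\<close>: half of Hamilton's equations, with \<open>x\<close> as the momentum.\<close>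

lemma PVI_slope:
  fixes t y y' x \<theta>1 \<theta>2 \<theta>3 :: complex
  assumes nz: "y \<noteq> 0" "y \<noteq> 1" "y \<noteq> t"
    and x: "2 * x = ((t - 1) * y' - \<theta>1) / y + (y' - 1 - \<theta>2) / (y - t) - (t * y' + \<theta>3) / (y - 1)"
  shows "t * (t - 1) * y' = 2 * x * (y * (y - 1) * (y - t)) +
     (\<theta>1 * (y - 1) * (y - t) + (1 + \<theta>2) * y * (y - 1) + \<theta>3 * y * (y - t))"
proof -
  have nz': "y - 1 \<noteq> 0" "y - t \<noteq> 0" using nz by auto
  have "2 * x * (y * (y - 1) * (y - t)) = ((t - 1) * y' - \<theta>1) * ((y - 1) * (y - t)) +
     (y' - 1 - \<theta>2) * (y * (y - 1)) - (t * y' + \<theta>3) * (y * (y - t))"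
    unfolding x using nz(1) nz' by (simp add: divide_simps) algebra
  then show ?thesis by algebra
qed

text \<open>The part free of \<open>x\<close> of the computation in the proof of the second Hamilton equation.\<close>

lemma PVI_quadratic_identity:
  fixes t y \<theta>1 \<theta>2 \<theta>3 \<theta>4 :: complex
  defines "f \<equiv> y * (y - 1) * (y - t)"
    and "g \<equiv> \<theta>1 * (y - 1) * (y - t) + (1 + \<theta>2) * y * (y - 1) + \<theta>3 * y * (y - t)"
    and "fy \<equiv> 3 * y\<^sup>2 - 2 * (1 + t) * y + t"
    and "gy \<equiv> \<theta>1 * (2 * y - 1 - t) + (1 + \<theta>2) * (2 * y - 1) + \<theta>3 * (2 * y - t)"
  shows "fy * g\<^sup>2 - 2 * (t * (t - 1)) * y * (y - 1) * g
    + (f\<^sup>2 * (\<theta>4 - 1)\<^sup>2 - \<theta>1\<^sup>2 * t * ((y - 1) * (y - t))\<^sup>2 + \<theta>3\<^sup>2 * (t - 1) * (y * (y - t))\<^sup>2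
       + (1 - \<theta>2\<^sup>2) * (t * (t - 1)) * (y * (y - 1))\<^sup>2)
    - 2 * f * g * gy + 2 * f * (t * (t - 1)) * (\<theta>1 * (y - 1) + \<theta>3 * y)
    = - (f\<^sup>2 * ((1 + \<theta>1 + \<theta>2 + \<theta>3)\<^sup>2 - (\<theta>4 - 1)\<^sup>2))"
  unfolding f_def g_def fy_def gy_def by algebra

lemma PVI_cleared:
  fixes t y y' y'' \<theta>1 \<theta>2 \<theta>3 \<theta>4 :: complex
  assumes nz: "t \<noteq> 0" "t \<noteq> 1" "y \<noteq> 0" "y \<noteq> 1" "y \<noteq> t"
    and PVI: "y'' = 1 / 2 * (1 / y + 1 / (y - 1) + 1 / (y - t)) * y'\<^sup>2
        - (1 / t + 1 / (t - 1) + 1 / (y - t)) * y'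
        + y * (y - 1) * (y - t) / (2 * t\<^sup>2 * (t - 1)\<^sup>2)
          * ((\<theta>4 - 1)\<^sup>2 - \<theta>1\<^sup>2 * t / y\<^sup>2 + \<theta>3\<^sup>2 * (t - 1) / (y - 1)\<^sup>2
             + (1 - \<theta>2\<^sup>2) * t * (t - 1) / (y - t)\<^sup>2)"
  defines "f \<equiv> y * (y - 1) * (y - t)" and "T \<equiv> t * (t - 1)"
    and "fy \<equiv> 3 * y\<^sup>2 - 2 * (1 + t) * y + t"
  shows "2 * T\<^sup>2 * f * y'' = fy * (T * y')\<^sup>2 - 2 * ((2 * t - 1) * f + T * y * (y - 1)) * (T * y')
    + (f\<^sup>2 * (\<theta>4 - 1)\<^sup>2 - \<theta>1\<^sup>2 * t * ((y - 1) * (y - t))\<^sup>2 + \<theta>3\<^sup>2 * (t - 1) * (y * (y - t))\<^sup>2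
       + (1 - \<theta>2\<^sup>2) * T * (y * (y - 1))\<^sup>2)"
proof -
  have nz': "y - 1 \<noteq> 0" "y - t \<noteq> 0" "t - 1 \<noteq> 0" "f \<noteq> 0" "T \<noteq> 0"
    using nz by (auto simp: f_def T_def)
  have 1: "f * (1 / y + 1 / (y - 1) + 1 / (y - t)) = fy"
    unfolding f_def fy_def using nz(3) nz' by (simp add: divide_simps) algebra
  have 2: "T * f * (1 / t + 1 / (t - 1) + 1 / (y - t)) = (2 * t - 1) * f + T * y * (y - 1)"
    unfolding f_def T_def using nz(1) nz' by (simp add: divide_simps) algebra
  have 3: "2 * T\<^sup>2 * (f / (2 * t\<^sup>2 * (t - 1)\<^sup>2)) = f"
    unfolding T_def using nz(1) nz' by (simp add: power_mult_distrib)
  have 4: "f\<^sup>2 * (\<theta>1\<^sup>2 * t / y\<^sup>2) = \<theta>1\<^sup>2 * t * ((y - 1) * (y - t))\<^sup>2"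
    "f\<^sup>2 * (\<theta>3\<^sup>2 * (t - 1) / (y - 1)\<^sup>2) = \<theta>3\<^sup>2 * (t - 1) * (y * (y - t))\<^sup>2"
    "f\<^sup>2 * ((1 - \<theta>2\<^sup>2) * t * (t - 1) / (y - t)\<^sup>2) = (1 - \<theta>2\<^sup>2) * T * (y * (y - 1))\<^sup>2"
    unfolding f_def T_def using nz(3) nz' by (simp_all add: power_mult_distrib)
  let ?Z = "(\<theta>4 - 1)\<^sup>2 - \<theta>1\<^sup>2 * t / y\<^sup>2 + \<theta>3\<^sup>2 * (t - 1) / (y - 1)\<^sup>2 + (1 - \<theta>2\<^sup>2) * t * (t - 1) / (y - t)\<^sup>2"
  define s1 s2 q where "s1 = 1 / y + 1 / (y - 1) + 1 / (y - t)"
    and "s2 = 1 / t + 1 / (t - 1) + 1 / (y - t)" and "q = f / (2 * t\<^sup>2 * (t - 1)\<^sup>2)"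
  have "y'' = 1 / 2 * s1 * y'\<^sup>2 - s2 * y' + q * ?Z"
    unfolding PVI f_def s1_def s2_def q_def ..
  then have "2 * y'' = s1 * y'\<^sup>2 - 2 * (s2 * y') + 2 * (q * ?Z)"
    by simp
  then have "2 * T\<^sup>2 * f * y'' = (f * s1) * (T * y')\<^sup>2 - 2 * (T * f * s2) * (T * y') + (2 * T\<^sup>2 * q) * (f * ?Z)"
    by algebra
  then have "2 * T\<^sup>2 * f * y'' = (f * (1 / y + 1 / (y - 1) + 1 / (y - t))) * (T * y')\<^sup>2
      - 2 * (T * f * (1 / t + 1 / (t - 1) + 1 / (y - t))) * (T * y')
      + (2 * T\<^sup>2 * (f / (2 * t\<^sup>2 * (t - 1)\<^sup>2))) * (f * ?Z)"
    unfolding s1_def s2_def q_def .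
  also have "(2 * T\<^sup>2 * (f / (2 * t\<^sup>2 * (t - 1)\<^sup>2))) * (f * ?Z) = f\<^sup>2 * ?Z"
    unfolding 3 by (simp add: power2_eq_square)
  also have "\<dots> = f\<^sup>2 * (\<theta>4 - 1)\<^sup>2 - f\<^sup>2 * (\<theta>1\<^sup>2 * t / y\<^sup>2) + f\<^sup>2 * (\<theta>3\<^sup>2 * (t - 1) / (y - 1)\<^sup>2)
      + f\<^sup>2 * ((1 - \<theta>2\<^sup>2) * t * (t - 1) / (y - t)\<^sup>2)"
    by (simp only: ring_distribs)
  finally show ?thesis
    unfolding 1 2 4 .
qed

text \<open>Differentiating the first Hamilton equation gives \<open>slope'\<close>, in which \<open>x'\<close> occurs linearly with the factor
  \<open>2 f\<close>.  Eliminating \<open>y''\<close> by the Painleve equation and \<open>y'\<close> by \<open>slope\<close> leaves a polynomial in \<open>x\<close> of degree two,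
  each of whose coefficients is divisible by \<open>f\<^sup>2\<close>.\<close>

lemma PVI_hamilton:
  fixes t y y' y'' x x' \<theta>1 \<theta>2 \<theta>3 \<theta>4 :: complex
  defines "f \<equiv> y * (y - 1) * (y - t)" and "T \<equiv> t * (t - 1)"
    and "g \<equiv> \<theta>1 * (y - 1) * (y - t) + (1 + \<theta>2) * y * (y - 1) + \<theta>3 * y * (y - t)"
    and "fy \<equiv> 3 * y\<^sup>2 - 2 * (1 + t) * y + t"
    and "gy \<equiv> \<theta>1 * (2 * y - 1 - t) + (1 + \<theta>2) * (2 * y - 1) + \<theta>3 * (2 * y - t)"
  assumes f: "f \<noteq> 0"
    and slope: "T * y' = 2 * x * f + g"
    and slope': "(2 * t - 1) * y' + T * y'' = 2 * x' * f + 2 * x * (fy * y' - y * (y - 1))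
       + (gy * y' - \<theta>1 * (y - 1) - \<theta>3 * y)"
    and PVI: "2 * T\<^sup>2 * f * y'' = fy * (T * y')\<^sup>2 - 2 * ((2 * t - 1) * f + T * y * (y - 1)) * (T * y')
    + (f\<^sup>2 * (\<theta>4 - 1)\<^sup>2 - \<theta>1\<^sup>2 * t * ((y - 1) * (y - t))\<^sup>2 + \<theta>3\<^sup>2 * (t - 1) * (y * (y - t))\<^sup>2
       + (1 - \<theta>2\<^sup>2) * T * (y * (y - 1))\<^sup>2)"
  shows "T * x' = - (x\<^sup>2 * fy + x * gy + ((1 + \<theta>1 + \<theta>2 + \<theta>3)\<^sup>2 - (\<theta>4 - 1)\<^sup>2) / 4)"
proof -
  define Z where "Z = f\<^sup>2 * (\<theta>4 - 1)\<^sup>2 - \<theta>1\<^sup>2 * t * ((y - 1) * (y - t))\<^sup>2 + \<theta>3\<^sup>2 * (t - 1) * (y * (y - t))\<^sup>2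
       + (1 - \<theta>2\<^sup>2) * T * (y * (y - 1))\<^sup>2"
  define c where "c = (1 + \<theta>1 + \<theta>2 + \<theta>3)\<^sup>2 - (\<theta>4 - 1)\<^sup>2"
  have Z: "fy * g\<^sup>2 - 2 * T * y * (y - 1) * g + Z - 2 * f * g * gy + 2 * f * T * (\<theta>1 * (y - 1) + \<theta>3 * y)
      = - (f\<^sup>2 * c)"
    unfolding Z_def c_def f_def T_def g_def fy_def gy_def by (rule PVI_quadratic_identity)
  have "T * x' * (4 * f\<^sup>2) = 2 * T\<^sup>2 * f * y'' + 2 * f * (2 * t - 1) * (T * y')
      - 4 * x * f * fy * (T * y') + 4 * x * f * T * (y * (y - 1)) - 2 * f * gy * (T * y')
      + 2 * f * T * (\<theta>1 * (y - 1) + \<theta>3 * y)"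
    using slope' by algebra
  also have "\<dots> = - (x\<^sup>2 * fy + x * gy) * (4 * f\<^sup>2) - f\<^sup>2 * c"
    unfolding PVI[folded Z_def] slope using Z by algebra
  finally have "(T * x' + (x\<^sup>2 * fy + x * gy + c / 4)) * (4 * f\<^sup>2) = 0"
    by (simp add: distrib_right left_diff_distrib)
  with f show ?thesis
    unfolding c_def by (simp only: eq_neg_iff_add_eq_0 mult_eq_0_iff power_eq_0_iff zero_neq_numeral) simp
qed

section \<open>The Schlesinger equations of the three-dimensional family\<close>

text \<open>The first three conclusions are the images of Hamilton's equations under the polynomial
  parametrisation of \<open>b12\<close>, \<open>b13\<close> and \<open>b21\<close> by \<open>x\<close> and \<open>y\<close>.  The other three follow from them: the formulas for
  \<open>b23\<close>, \<open>b31\<close> and \<open>b32\<close> say that \<open>(1, 1, t)\<close> is a left eigenvector of \<open>B1 + B2 + B3\<close> with eigenvalue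
  \<open>\<mu>2\<close>, and the deformation preserves this.\<close>

lemma schlesinger_scalar_equations:
  fixes t y y' x x' lam1 lam2 lam3 \<mu>1 \<mu>2 \<mu>3 b12 b13 b21 b23 b31 b32 b12' b13' b21' b23' b31' b32' :: complex
  assumes t: "t \<noteq> 0" "t \<noteq> 1"
    and lam3: "lam3 = \<mu>1 + \<mu>2 + \<mu>3 - lam1 - lam2"
    and y': "t * (t - 1) * y' = 2 * x * (y * (y - 1) * (y - t)) +
       ((lam1 - \<mu>1) * (y - 1) * (y - t) + (1 + (lam2 - \<mu>1)) * y * (y - 1) + (lam3 - \<mu>1) * y * (y - t))"
    and x': "t * (t - 1) * x' = - (x\<^sup>2 * (3 * y\<^sup>2 - 2 * (1 + t) * y + t) +
       x * ((lam1 - \<mu>1) * (2 * y - 1 - t) + (1 + (lam2 - \<mu>1)) * (2 * y - 1) + (lam3 - \<mu>1) * (2 * y - t)) +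
       (\<mu>2 - \<mu>1 + 1) * (\<mu>3 - \<mu>1))"
    and b12: "b12 = lam1 - \<mu>3 * y + (\<mu>1 - x * y) * (y - 1)"
    and b13: "b13 = lam1 * t - \<mu>3 * y + (\<mu>1 - x * y) * (y - t)"
    and b21: "(t - 1) * b21 = (t - 1) * lam2 + (\<mu>3 * (y - t) - \<mu>1 * (y - 1) + x * (y - t) * (y - 1))"
    and b23: "b23 = (\<mu>2 - lam3) * t - b13"
    and b32: "t * b32 = \<mu>2 - lam2 - b12" and b31: "t * b31 = \<mu>2 - lam1 - b21"
    and b12': "b12' = - \<mu>3 * y' + (\<mu>1 - x * y) * y' - (x' * y + x * y') * (y - 1)"
    and b13': "b13' = lam1 - \<mu>3 * y' + (\<mu>1 - x * y) * (y' - 1) - (x' * y + x * y') * (y - t)"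
    and b21': "(t - 1) * b21' + b21 = lam2 + (\<mu>3 * (y' - 1) - \<mu>1 * y' + x' * (y - t) * (y - 1)
       + x * ((y' - 1) * (y - 1) + (y - t) * y'))"
    and b23': "b23' = \<mu>2 - lam3 - b13'" and b32': "t * b32' + b32 = - b12'"
    and b31': "t * b31' + b31 = - b21'"
  shows "t * (t - 1) * b12' = (t - 1) * b12 * (b21 + lam1 - b12 - lam2) - t * (t * b12 - b13) * b32" (is ?E12)
    and "t * (t - 1) * b13' = (t - 1) * b13 * (b21 + 1) + b12 * b23 - b13 * b23" (is ?E13)
    and "t * (t - 1) * b21' = (t - 1) * b21 * (b12 - b21 - lam1 + lam2) + t\<^sup>2 * b32 * b21 - t * b23 * b31" (is ?E21)
    and "t * (t - 1) * b23' = (t - 1) * b23 * (b12 + 1) + t\<^sup>2 * b32 * b23 - (t - 1) * b21 * b13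
        + t * lam2 * b23 - b23 * b23 - t * b23 * lam3" (is ?E23)
    and "t * (t - 1) * b31' = (b23 - (t - 1)) * b31 - (t - 1) * b31 * b21 - b32 * b21" (is ?E31)
    and "t * (t - 1) * b32' = (b23 - (t - 1)) * b32 + (t - 1) * b31 * b12 - (t - 1) * b32 * b12
        - t\<^sup>2 * b32 * b32 - t * b32 * lam2 + t * lam3 * b32" (is ?E32)
proof -
  have t': "t - 1 \<noteq> 0" using t by simp
  have "t * (t - 1) * b12' = (\<mu>1 - \<mu>3 - x * y - x * (y - 1)) * (t * (t - 1) * y')
      - y * (y - 1) * (t * (t - 1) * x')"
    unfolding b12' by algebra
  also have "\<dots> = b12 * (((t - 1) * b21) + (t - 1) * (lam1 - b12 - lam2)) - (t * b12 - b13) * (t * b32)"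
    unfolding y' x' b21 b32 b12 b13 lam3 by algebra
  finally show E12: ?E12 by algebra
  have "t * (t - 1) * b13' = (\<mu>1 - \<mu>3 - x * y - x * (y - t)) * (t * (t - 1) * y')
      - y * (y - t) * (t * (t - 1) * x') + t * (t - 1) * (lam1 - (\<mu>1 - x * y))"
    unfolding b13' by algebra
  also have "\<dots> = b13 * ((t - 1) * b21 + (t - 1)) + b12 * b23 - b13 * b23"
    unfolding y' x' b21 b23 b12 b13 lam3 by algebra
  finally show E13: ?E13 by algebra
  have "(t * (t - 1) * b21') * (t - 1) = t * (t - 1) * ((t - 1) * b21' + b21) - t * ((t - 1) * b21)"
    by algebra
  also have "\<dots> = (\<mu>3 - \<mu>1 + x * (y - 1) + x * (y - t)) * (t * (t - 1) * y') + (y - t) * (y - 1) * (t * (t - 1) * x')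
      + t * (t - 1) * (lam2 - \<mu>3 - x * (y - 1)) - t * ((t - 1) * b21)"
    unfolding b21' by algebra
  also have "\<dots> = ((t - 1) * b21) * ((t - 1) * (b12 - lam1 + lam2) - (t - 1) * b21) + t * (t * b32) * ((t - 1) * b21)
      - b23 * ((t - 1) * (\<mu>2 - lam1) - (t - 1) * b21)"
    unfolding y' x' b21 b32 b23 b12 b13 lam3 by algebra
  also have "\<dots> = ((t - 1) * b21 * (b12 - b21 - lam1 + lam2) + t\<^sup>2 * b32 * b21 - b23 * (t * b31)) * (t - 1)"
    unfolding b31 by algebra
  finally show E21: ?E21 using t' by (simp add: mult.left_commute mult.commute)
  show ?E23
    unfolding b23' using E13 b23 b32 lam3 by algebra
  have "t * (t * (t - 1) * b31') = t * ((b23 - (t - 1)) * b31 - (t - 1) * b31 * b21 - b32 * b21)"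
    using E21 b31' b31 b32 b23 by algebra
  then show ?E31 using t(1) by simp
  have "t * (t * (t - 1) * b32') = t * ((b23 - (t - 1)) * b32 + (t - 1) * b31 * b12 - (t - 1) * b32 * b12
        - t\<^sup>2 * b32 * b32 - t * b32 * lam2 + t * lam3 * b32)"
    using E12 b32' b32 b31 b23 by algebra
  then show ?E32 using t(1) by simp
qed

text \<open>The entries off the diagonal are dictated by the shape of the system.  The image of \<open>Bi\<close> is to remain
  the line of the \<open>i\<close>-th standard vector, which must therefore be an eigenvector of the matrix whose commutator
  with \<open>Bi\<close> is the derivative of \<open>Bi\<close>, such as \<open>P + B2 / t\<close> for \<open>B1\<close>.  The diagonal is fixed by
  the left eigenvector \<open>v = (1, 1, t)\<close> of \<open>B1 + B2 + B3\<close>, through the condition \<open>v' + v P = 0\<close>.\<close>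

definition gauge3 :: "complex \<Rightarrow> complex \<Rightarrow> complex \<Rightarrow> complex \<Rightarrow> complex \<Rightarrow> complex^3^3" where
  "gauge3 t b12 b21 b23 b32 = vector
     [vector [b21 / t, - (b12 / t), 0],
      vector [- (b21 / t), b12 / t + t * b32 / (t - 1), - (b23 / (t - 1))],
      vector [0, - (b32 / (t - 1)), (b23 / (t - 1) - 1) / t]]"

lemma schlesinger_matrix_equations:
  fixes t lam1 lam2 lam3 b12 b13 b21 b23 b31 b32 b12' b13' b21' b23' b31' b32' :: complex
  assumes t: "t \<noteq> 0" "t \<noteq> 1"
    and E12: "t * (t - 1) * b12' = (t - 1) * b12 * (b21 + lam1 - b12 - lam2) - t * (t * b12 - b13) * b32"
    and E13: "t * (t - 1) * b13' = (t - 1) * b13 * (b21 + 1) + b12 * b23 - b13 * b23"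
    and E21: "t * (t - 1) * b21' = (t - 1) * b21 * (b12 - b21 - lam1 + lam2) + t\<^sup>2 * b32 * b21 - t * b23 * b31"
    and E23: "t * (t - 1) * b23' = (t - 1) * b23 * (b12 + 1) + t\<^sup>2 * b32 * b23 - (t - 1) * b21 * b13
        + t * lam2 * b23 - b23 * b23 - t * b23 * lam3"
    and E31: "t * (t - 1) * b31' = (b23 - (t - 1)) * b31 - (t - 1) * b31 * b21 - b32 * b21"
    and E32: "t * (t - 1) * b32' = (b23 - (t - 1)) * b32 + (t - 1) * b31 * b12 - (t - 1) * b32 * b12
        - t\<^sup>2 * b32 * b32 - t * b32 * lam2 + t * lam3 * b32"
  defines "B1 \<equiv> vector [vector [lam1, b12, b13], vector [0, 0, 0], vector [0, 0, 0]] :: complex^3^3"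
    and "B2 \<equiv> vector [vector [0, 0, 0], vector [b21, lam2, b23], vector [0, 0, 0]] :: complex^3^3"
    and "B3 \<equiv> vector [vector [0, 0, 0], vector [0, 0, 0], vector [b31, b32, lam3]] :: complex^3^3"
    and "B1' \<equiv> vector [vector [0, b12', b13'], vector [0, 0, 0], vector [0, 0, 0]] :: complex^3^3"
    and "B2' \<equiv> vector [vector [0, 0, 0], vector [b21', 0, b23'], vector [0, 0, 0]] :: complex^3^3"
    and "B3' \<equiv> vector [vector [0, 0, 0], vector [0, 0, 0], vector [b31', b32', 0]] :: complex^3^3"
    and "P \<equiv> gauge3 t b12 b21 b23 b32"
  shows "B1' $ i $ j = (P ** B1 - B1 ** P) $ i $ j + (B2 ** B1 - B1 ** B2) $ i $ j / t"
    and "B2' $ i $ j = (P ** B2 - B2 ** P) $ i $ j - (B2 ** B1 - B1 ** B2) $ i $ j / t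
       - (B2 ** B3 - B3 ** B2) $ i $ j / (t - 1)"
    and "B3' $ i $ j = (P ** B3 - B3 ** P) $ i $ j + (B2 ** B3 - B3 ** B2) $ i $ j / (t - 1)"
proof -
  have t': "t - 1 \<noteq> 0" using t by simp
  \<comment> \<open>with the reciprocals as unknowns, every entry becomes a polynomial identity modulo \<open>uv\<close>\<close>
  define u v where "u = 1 / t" and "v = 1 / (t - 1)"
  have uv: "u * t = 1" "v * (t - 1) = 1" using t(1) t' by (simp_all add: u_def v_def)
  have div: "w / t = w * u" "w / (t - 1) = w * v" for w
    by (simp_all add: u_def v_def)
  have "\<forall>i j. B1' $ i $ j = (P ** B1 - B1 ** P) $ i $ j + (B2 ** B1 - B1 ** B2) $ i $ j / t"
    unfolding B1_def B2_def B1'_def P_def gauge3_def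
    apply (simp add: forall_3 matrix_matrix_mult_def sum_3 vector_3 div)
    apply (intro conjI)
    using E12 E13 uv by algebra+
  then show "B1' $ i $ j = (P ** B1 - B1 ** P) $ i $ j + (B2 ** B1 - B1 ** B2) $ i $ j / t"
    by blast
  have "\<forall>i j. B2' $ i $ j = (P ** B2 - B2 ** P) $ i $ j - (B2 ** B1 - B1 ** B2) $ i $ j / t
       - (B2 ** B3 - B3 ** B2) $ i $ j / (t - 1)"
    unfolding B1_def B2_def B3_def B2'_def P_def gauge3_def
    apply (simp add: forall_3 matrix_matrix_mult_def sum_3 vector_3 div)
    apply (intro conjI)
    using E21 E23 uv by algebra+
  then show "B2' $ i $ j = (P ** B2 - B2 ** P) $ i $ j - (B2 ** B1 - B1 ** B2) $ i $ j / t
       - (B2 ** B3 - B3 ** B2) $ i $ j / (t - 1)"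
    by blast
  have "\<forall>i j. B3' $ i $ j = (P ** B3 - B3 ** P) $ i $ j + (B2 ** B3 - B3 ** B2) $ i $ j / (t - 1)"
    unfolding B2_def B3_def B3'_def P_def gauge3_def
    apply (simp add: forall_3 matrix_matrix_mult_def sum_3 vector_3 div)
    apply (intro conjI)
    using E31 E32 uv by algebra+
  then show "B3' $ i $ j = (P ** B3 - B3 ** P) $ i $ j + (B2 ** B3 - B3 ** B2) $ i $ j / (t - 1)"
    by blast
qed

section \<open>Painleve VI governs isomonodromic deformations\<close>

lemma DERIV_unique_on_open:
  fixes F G :: "complex \<Rightarrow> complex"
  assumes "open U" "t \<in> U" "\<And>s. s \<in> U \<Longrightarrow> F s = G s"
    and F: "(F has_field_derivative D) (at t)" and G: "(G has_field_derivative E) (at t)"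
  shows "D = E"
  using has_field_derivative_transform_within_open[OF F assms(1-3)] G DERIV_unique by blast

theorem mainTheorem3:
  fixes lam1 lam2 lam3 \<mu>1 \<mu>2 \<mu>3 \<theta>1 \<theta>2 \<theta>3 \<theta>4 :: complex
    and U :: "complex set"
    and y x b12 b13 b21 b23 b31 b32 :: "complex \<Rightarrow> complex"
    and B1 B2 B3 :: "complex \<Rightarrow> complex^3^3"
  assumes "lam1 + lam2 + lam3 = \<mu>1 + \<mu>2 + \<mu>3"
    and "\<theta>1 = lam1 - \<mu>1" and "\<theta>2 = lam2 - \<mu>1" and "\<theta>3 = lam3 - \<mu>1" and "\<theta>4 = \<mu>3 - \<mu>2"
    and "open U" and "0 \<notin> U" and "1 \<notin> U"
    and "solves_PVI_on U \<theta>1 \<theta>2 \<theta>3 \<theta>4 y"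
    and "\<And>t. t \<in> U \<Longrightarrow> y t \<noteq> 0 \<and> y t \<noteq> 1 \<and> y t \<noteq> t"
    and "\<And>t. t \<in> U \<Longrightarrow> 2 * x t =
           ((t - 1) * deriv y t - \<theta>1) / y t + (deriv y t - 1 - \<theta>2) / (y t - t)
           - (t * deriv y t + \<theta>3) / (y t - 1)"
    and "\<And>t. t \<in> U \<Longrightarrow> b12 t = lam1 - \<mu>3 * y t + (\<mu>1 - x t * y t) * (y t - 1)"
    and "\<And>t. t \<in> U \<Longrightarrow> b32 t = (\<mu>2 - lam2 - b12 t) / t"
    and "\<And>t. t \<in> U \<Longrightarrow> b13 t = lam1 * t - \<mu>3 * y t + (\<mu>1 - x t * y t) * (y t - t)"
    and "\<And>t. t \<in> U \<Longrightarrow> b23 t = (\<mu>2 - lam3) * t - b13 t"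
    and "\<And>t. t \<in> U \<Longrightarrow> b21 t = lam2 +
           (\<mu>3 * (y t - t) - \<mu>1 * (y t - 1) + x t * (y t - t) * (y t - 1)) / (t - 1)"
    and "\<And>t. t \<in> U \<Longrightarrow> b31 t = (\<mu>2 - lam1 - b21 t) / t"
    and "\<And>t. t \<in> U \<Longrightarrow> B1 t = vector [vector [lam1, b12 t, b13 t], vector [0, 0, 0], vector [0, 0, 0]]"
    and "\<And>t. t \<in> U \<Longrightarrow> B2 t = vector [vector [0, 0, 0], vector [b21 t, lam2, b23 t], vector [0, 0, 0]]"
    and "\<And>t. t \<in> U \<Longrightarrow> B3 t = vector [vector [0, 0, 0], vector [0, 0, 0], vector [b31 t, b32 t, lam3]]"
  shows "isomonodromic_on U (\<lambda>t. fuchsian_matrix (B1 t) (B2 t) (B3 t) t)"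
proof -
  note U = assms(6-8)
  note \<theta> = assms(2-5)
  note nzy = assms(10)
  note x = assms(11)
  note b = assms(12-17)
  note B = assms(18-20)
  have lam3: "lam3 = \<mu>1 + \<mu>2 + \<mu>3 - lam1 - lam2"
    using assms(1) by algebra
  have y_hol: "y holomorphic_on U"
    using assms(9) by (simp add: solves_PVI_on_def)
  then have dy_hol: "deriv y holomorphic_on U"
    using U(1) by (rule holomorphic_deriv)
  have nzt: "t \<noteq> 0" "t \<noteq> 1" if "t \<in> U" for t
    using that U by auto
  have "(\<lambda>t. (((t - 1) * deriv y t - \<theta>1) / y t + (deriv y t - 1 - \<theta>2) / (y t - t)
           - (t * deriv y t + \<theta>3) / (y t - 1)) / 2) holomorphic_on U"
    by (intro holomorphic_intros y_hol dy_hol) (use nzy in auto)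
  then have x_hol: "x holomorphic_on U"
    by (rule holomorphic_transform) (use x in \<open>simp add: field_simps\<close>)
  have "(\<lambda>t. lam1 - \<mu>3 * y t + (\<mu>1 - x t * y t) * (y t - 1)) holomorphic_on U"
    by (intro holomorphic_intros y_hol x_hol)
  then have b12_hol: "b12 holomorphic_on U"
    by (rule holomorphic_transform) (simp add: b)
  have "(\<lambda>t. lam1 * t - \<mu>3 * y t + (\<mu>1 - x t * y t) * (y t - t)) holomorphic_on U"
    by (intro holomorphic_intros y_hol x_hol)
  then have b13_hol: "b13 holomorphic_on U"
    by (rule holomorphic_transform) (simp add: b)
  have "(\<lambda>t. lam2 + (\<mu>3 * (y t - t) - \<mu>1 * (y t - 1) + x t * (y t - t) * (y t - 1)) / (t - 1)) holomorphic_on U"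
    by (intro holomorphic_intros y_hol x_hol) (use U in auto)
  then have b21_hol: "b21 holomorphic_on U"
    by (rule holomorphic_transform) (simp add: b)
  have "(\<lambda>t. (\<mu>2 - lam2 - b12 t) / t) holomorphic_on U"
    by (intro holomorphic_intros b12_hol) (use U in auto)
  then have b32_hol: "b32 holomorphic_on U"
    by (rule holomorphic_transform) (simp add: b(2))
  have "(\<lambda>t. (\<mu>2 - lam3) * t - b13 t) holomorphic_on U"
    by (intro holomorphic_intros b13_hol)
  then have b23_hol: "b23 holomorphic_on U"
    by (rule holomorphic_transform) (simp add: b(4))
  have "(\<lambda>t. (\<mu>2 - lam1 - b21 t) / t) holomorphic_on U"
    by (intro holomorphic_intros b21_hol) (use U in auto)
  then have b31_hol: "b31 holomorphic_on U"
    by (rule holomorphic_transform) (simp add: b(6))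
  note D = holomorphic_derivI[OF _ U(1)]
  note Dy = D[OF y_hol] and Ddy = D[OF dy_hol] and Dx = D[OF x_hol]
  note Db = D[OF b12_hol] D[OF b13_hol] D[OF b21_hol] D[OF b23_hol] D[OF b31_hol] D[OF b32_hol]
  note unique = DERIV_unique_on_open[OF U(1)]
  have slope: "t * (t - 1) * deriv y t = 2 * x t * (y t * (y t - 1) * (y t - t)) +
     (\<theta>1 * (y t - 1) * (y t - t) + (1 + \<theta>2) * y t * (y t - 1) + \<theta>3 * y t * (y t - t))"
    if "t \<in> U" for t
    using PVI_slope[OF _ _ _ x[OF that]] nzy[OF that] by blast
  have slope': "(2 * t - 1) * deriv y t + t * (t - 1) * deriv (deriv y) t =
      2 * deriv x t * (y t * (y t - 1) * (y t - t))
      + 2 * x t * ((3 * (y t)\<^sup>2 - 2 * (1 + t) * y t + t) * deriv y t - y t * (y t - 1))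
      + ((\<theta>1 * (2 * y t - 1 - t) + (1 + \<theta>2) * (2 * y t - 1) + \<theta>3 * (2 * y t - t)) * deriv y t
         - \<theta>1 * (y t - 1) - \<theta>3 * y t)" if t: "t \<in> U" for t
  proof (rule unique[OF t slope])
    show "((\<lambda>t. t * (t - 1) * deriv y t) has_field_derivative
        (2 * t - 1) * deriv y t + t * (t - 1) * deriv (deriv y) t) (at t)"
      by (rule derivative_eq_intros Ddy t refl | simp)+
    show "((\<lambda>t. 2 * x t * (y t * (y t - 1) * (y t - t)) +
        (\<theta>1 * (y t - 1) * (y t - t) + (1 + \<theta>2) * y t * (y t - 1) + \<theta>3 * y t * (y t - t)))
      has_field_derivative 2 * deriv x t * (y t * (y t - 1) * (y t - t))
      + 2 * x t * ((3 * (y t)\<^sup>2 - 2 * (1 + t) * y t + t) * deriv y t - y t * (y t - 1))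
      + ((\<theta>1 * (2 * y t - 1 - t) + (1 + \<theta>2) * (2 * y t - 1) + \<theta>3 * (2 * y t - t)) * deriv y t
         - \<theta>1 * (y t - 1) - \<theta>3 * y t)) (at t)"
      by (rule derivative_eq_intros Dx Dy t refl)+ algebra
  qed
  have hamilton: "t * (t - 1) * deriv x t = - ((x t)\<^sup>2 * (3 * (y t)\<^sup>2 - 2 * (1 + t) * y t + t) +
       x t * (\<theta>1 * (2 * y t - 1 - t) + (1 + \<theta>2) * (2 * y t - 1) + \<theta>3 * (2 * y t - t)) +
       ((1 + \<theta>1 + \<theta>2 + \<theta>3)\<^sup>2 - (\<theta>4 - 1)\<^sup>2) / 4)" if t: "t \<in> U" for t
  proof (rule PVI_hamilton[OF _ slope[OF t] slope'[OF t]])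
    show "y t * (y t - 1) * (y t - t) \<noteq> 0" using nzy[OF t] by simp
  qed (rule PVI_cleared; use nzt[OF t] nzy[OF t] assms(9) t in \<open>simp add: solves_PVI_on_def\<close>)
  have "(1 + \<theta>1 + \<theta>2 + \<theta>3)\<^sup>2 - (\<theta>4 - 1)\<^sup>2 = 4 * ((\<mu>2 - \<mu>1 + 1) * (\<mu>3 - \<mu>1))"
    unfolding \<theta> lam3 by algebra
  then have c: "((1 + \<theta>1 + \<theta>2 + \<theta>3)\<^sup>2 - (\<theta>4 - 1)\<^sup>2) / 4 = (\<mu>2 - \<mu>1 + 1) * (\<mu>3 - \<mu>1)"
    by simp
  have b21: "(t - 1) * b21 t = (t - 1) * lam2 + (\<mu>3 * (y t - t) - \<mu>1 * (y t - 1) + x t * (y t - t) * (y t - 1))"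
    and b32: "t * b32 t = \<mu>2 - lam2 - b12 t" and b31: "t * b31 t = \<mu>2 - lam1 - b21 t" if "t \<in> U" for t
  proof -
    have cancel: "(t - 1) * (q + p / (t - 1)) = (t - 1) * q + p" for p q
      using nzt(2)[OF that] by (simp add: field_simps)
    show "(t - 1) * b21 t = (t - 1) * lam2 + (\<mu>3 * (y t - t) - \<mu>1 * (y t - 1) + x t * (y t - t) * (y t - 1))"
      unfolding b(5)[OF that] by (rule cancel)
    show "t * b32 t = \<mu>2 - lam2 - b12 t" "t * b31 t = \<mu>2 - lam1 - b21 t"
      using nzt(1)[OF that] b(2)[OF that] b(6)[OF that] by simp_all
  qed
  have b12': "deriv b12 t = - \<mu>3 * deriv y t + (\<mu>1 - x t * y t) * deriv y t
      - (deriv x t * y t + x t * deriv y t) * (y t - 1)" if t: "t \<in> U" for t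
    by (rule unique[OF t b(1) Db(1)[OF t]], assumption)
      ((rule derivative_eq_intros Dx Dy t refl)+, algebra)+
  have b13': "deriv b13 t = lam1 - \<mu>3 * deriv y t + (\<mu>1 - x t * y t) * (deriv y t - 1)
      - (deriv x t * y t + x t * deriv y t) * (y t - t)" if t: "t \<in> U" for t
    by (rule unique[OF t b(3) Db(2)[OF t]], assumption)
      ((rule derivative_eq_intros Dx Dy t refl)+, algebra)+
  have b21': "(t - 1) * deriv b21 t + b21 t = lam2 + (\<mu>3 * (deriv y t - 1) - \<mu>1 * deriv y t
      + deriv x t * (y t - t) * (y t - 1)
      + x t * ((deriv y t - 1) * (y t - 1) + (y t - t) * deriv y t))" if t: "t \<in> U" for t
    by (rule unique[OF t b21], assumption) ((rule derivative_eq_intros Dx Dy Db t refl)+, algebra)+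
  have b23': "deriv b23 t = \<mu>2 - lam3 - deriv b13 t" if t: "t \<in> U" for t
    by (rule unique[OF t b(4) Db(4)[OF t]], assumption) ((rule derivative_eq_intros Db t refl)+, algebra)+
  have b32': "t * deriv b32 t + b32 t = - deriv b12 t" if t: "t \<in> U" for t
    by (rule unique[OF t b32], assumption) ((rule derivative_eq_intros Db t refl)+, algebra)+
  have b31': "t * deriv b31 t + b31 t = - deriv b21 t" if t: "t \<in> U" for t
    by (rule unique[OF t b31], assumption) ((rule derivative_eq_intros Db t refl)+, algebra)+
  define B1' :: "complex \<Rightarrow> complex^3^3" where
    "B1' t = vector [vector [0, deriv b12 t, deriv b13 t], vector [0, 0, 0], vector [0, 0, 0]]" for t
  define B2' :: "complex \<Rightarrow> complex^3^3" where
    "B2' t = vector [vector [0, 0, 0], vector [deriv b21 t, 0, deriv b23 t], vector [0, 0, 0]]" for t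
  define B3' :: "complex \<Rightarrow> complex^3^3" where
    "B3' t = vector [vector [0, 0, 0], vector [0, 0, 0], vector [deriv b31 t, deriv b32 t, 0]]" for t
  define P where "P t = gauge3 t (b12 t) (b21 t) (b23 t) (b32 t)" for t
  have dB: "has_matrix_derivative B1 (B1' t) t" "has_matrix_derivative B2 (B2' t) t"
    "has_matrix_derivative B3 (B3' t) t" if t: "t \<in> U" for t
  proof -
    have "has_matrix_derivative (\<lambda>t. vector [vector [lam1, b12 t, b13 t], vector [0, 0, 0], vector [0, 0, 0]]
      :: complex^3^3) (B1' t) t"
      by (simp add: has_matrix_derivative_def forall_3 vector_3 B1'_def Db t)
    then show "has_matrix_derivative B1 (B1' t) t"
      by (rule has_matrix_derivative_cong[OF _ U(1) t]) (simp add: B)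
    have "has_matrix_derivative (\<lambda>t. vector [vector [0, 0, 0], vector [b21 t, lam2, b23 t], vector [0, 0, 0]]
      :: complex^3^3) (B2' t) t"
      by (simp add: has_matrix_derivative_def forall_3 vector_3 B2'_def Db t)
    then show "has_matrix_derivative B2 (B2' t) t"
      by (rule has_matrix_derivative_cong[OF _ U(1) t]) (simp add: B)
    have "has_matrix_derivative (\<lambda>t. vector [vector [0, 0, 0], vector [0, 0, 0], vector [b31 t, b32 t, lam3]]
      :: complex^3^3) (B3' t) t"
      by (simp add: has_matrix_derivative_def forall_3 vector_3 B3'_def Db t)
    then show "has_matrix_derivative B3 (B3' t) t"
      by (rule has_matrix_derivative_cong[OF _ U(1) t]) (simp add: B)
  qed
  have "\<forall>i j. (\<lambda>t. P t $ i $ j) holomorphic_on U"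
    unfolding P_def gauge3_def using nzt
    by (auto simp: forall_3 vector_3 intro!: holomorphic_intros b12_hol b21_hol b23_hol b32_hol)
  then have P_hol: "(\<lambda>t. P t $ i $ j) holomorphic_on U" for i j
    by blast
  note scalar = schlesinger_scalar_equations[OF nzt lam3 slope[unfolded \<theta>]
      hamilton[unfolded c, unfolded \<theta>] b(1,3) b21 b(4) b32 b31 b12' b13' b21' b23' b32' b31']
  note schlesinger = schlesinger_matrix_equations[OF nzt scalar, folded B1'_def B2'_def B3'_def P_def]
  have frames: "\<exists>e>0. \<exists>\<Phi> \<Xi>. flat_frame (\<lambda>t. fuchsian_matrix (B1 t) (B2 t) (B3 t) t)
    (\<lambda>t. deformation_matrix (P t) (B2 t) t) t z e \<Phi> \<Xi>" if "t \<in> U" "z \<notin> {0, t, 1}" for t z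
    by (rule schlesinger_flat_frame[OF U dB P_hol _ _ _ that]) (simp_all only: B schlesinger)
  define good where "good p e \<Phi> \<Xi> \<longleftrightarrow> 0 < e \<and> flat_frame (\<lambda>t. fuchsian_matrix (B1 t) (B2 t) (B3 t) t)
    (\<lambda>t. deformation_matrix (P t) (B2 t) t) (fst p) (snd p) e \<Phi> \<Xi>" for p e \<Phi> \<Xi>
  have "\<exists>e \<Phi> \<Xi>. good p e \<Phi> \<Xi>" if "p \<in> punctured_spheres U" for p
    using frames[of "fst p" "snd p"] that unfolding good_def punctured_spheres_def by auto
  then obtain rad \<Phi> \<Xi> where good: "\<And>p. p \<in> punctured_spheres U \<Longrightarrow> good p (rad p) (\<Phi> p) (\<Xi> p)"
    by metis
  interpret flat_connection "\<lambda>t. fuchsian_matrix (B1 t) (B2 t) (B3 t) t"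
    "\<lambda>t. deformation_matrix (P t) (B2 t) t" "punctured_spheres U" rad \<Phi> \<Xi>
    using good unfolding good_def by unfold_locales blast+
  show ?thesis
    by (rule isomonodromic) (simp add: punctured_spheres_def)
qed

end
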